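(* Let $0\le r_m\le r_p$ and let $\mathbf{X}^\star=(X_1^\star,X_2^\star)$ have the capacity-achieving input distribution for $\mathsf{C}(r_p,r_m)$. Then the marginals $P_{X_1^\star}$ and $P_{X_2^\star}$ are symmetric, i.e., $X_i^\star\stackrel{d}{=}-X_i^\star$ for $i=1,2$. Moreover, if $0<r_m\le r_p\le\sqrt{2}$, then the conditional distribution of $X_2^\star$ given $X_1^\star=x_1$, for $x_1\in[-r_p,r_p]$, is given by $$P_{X_2^\star\mid X_1^\star=x_1}(x_2)=\frac12\,\delta\!\left(x_2-r_m\sqrt{1-\frac{x_1^2}{r_p^2}}\right)+\frac12\,\delta\!\left(x_2+r_m\sqrt{1-\frac{x_1^2}{r_p^2}}\right).$$
   Context: For $r_p\ge r_m\ge 0$, $\mathcal{E}(r_p,r_m)=\{(x_1,x_2)\in\mathbb{R}^2: x_1^2/r_p^2+x_2^2/r_m^2\le 1\}$ (a zero radius forces the corresponding coordinate to be $0$). Let $\mathbf{Z}$ be a standard normal vector in $\mathbb{R}^2$ independent of $\mathbf{X}$, and $\mathsf{C}(r_p,r_m)=\max_{P_{\mathbf{X}}:\,\mathbf{X}\in\mathcal{E}(r_p,r_m)\text{ a.s.}} I(\mathbf{X};\mathbf{X}+\mathbf{Z})$, where $I$ is mutual information. The maximizing (capacity-achieving) distribution exists and is unique. $\stackrel{d}{=}$ denotes equality in distribution, and $\delta(\cdot - c)$ denotes the unit point mass at $c$. Conditional distributions are, as usual, understood up to $P_{X_1^\star}$-null sets: the claim is that the displayed kernel is a version of the regular conditional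 distribution. *)

theory Defs
  imports "HOL-Probability.Probability"
begin

text \<open>Points of the plane are pairs of reals. The last two conjuncts are needed because
  division by zero yields zero: they force a coordinate with zero radius to vanish.\<close>

definition ellipse :: "real \<Rightarrow> real \<Rightarrow> (real \<times> real) set" where
  "ellipse r\<^sub>p r\<^sub>m =
    {(x\<^sub>1, x\<^sub>2). x\<^sub>1\<^sup>2 / r\<^sub>p\<^sup>2 + x\<^sub>2\<^sup>2 / r\<^sub>m\<^sup>2 \<le> 1 \<and> (r\<^sub>p = 0 \<longrightarrow> x\<^sub>1 = 0) \<and> (r\<^sub>m = 0 \<longrightarrow> x\<^sub>2 = 0)}"

definition std_normal_plane :: "(real \<times> real) measure" where
  "std_normal_plane = std_normal_distribution \<Otimes>\<^sub>M std_normal_distribution"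

text \<open>Mutual information, in nats, between the input and the output of the additive channel
  for the input distribution \<open>P\<close>. Input and noise are the two projections of the product
  space, hence independent with laws \<open>P\<close> and \<open>std_normal_plane\<close>.\<close>

definition channel_information :: "(real \<times> real) measure \<Rightarrow> real" where
  "channel_information P =
    prob_space.mutual_information (P \<Otimes>\<^sub>M std_normal_plane) (exp 1) borel borel
      (\<lambda>(x, z). x) (\<lambda>(x, z). x + z)"

definition admissible_input :: "real \<Rightarrow> real \<Rightarrow> (real \<times> real) measure \<Rightarrow> bool" where
  "admissible_input r\<^sub>p r\<^sub>m P \<longleftrightarrow>
    prob_space P \<and> sets P = sets borel \<and> (AE x in P. x \<in> ellipse r\<^sub>p r\<^sub>m)"

definition capacity_achieving :: "real \<Rightarrow> real \<Rightarrow> (real \<times> real) measure \<Rightarrow> bool" where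
  "capacity_achieving r\<^sub>p r\<^sub>m P \<longleftrightarrow>
    is_arg_max channel_information (admissible_input r\<^sub>p r\<^sub>m) P"

text \<open>The kernel \<open>K\<close> is a version of the regular conditional distribution of \<open>Y\<close> given \<open>X\<close>.\<close>

definition is_regular_cond_distr ::
  "'a measure \<Rightarrow> 'b measure \<Rightarrow> 'c measure \<Rightarrow> ('a \<Rightarrow> 'b) \<Rightarrow> ('a \<Rightarrow> 'c) \<Rightarrow> ('b \<Rightarrow> 'c measure) \<Rightarrow> bool" where
  "is_regular_cond_distr M S T X Y K \<longleftrightarrow>
    K \<in> measurable S (prob_algebra T) \<and>
    (\<forall>A\<in>sets S. \<forall>B\<in>sets T.
      emeasure M {\<omega> \<in> space M. X \<omega> \<in> A \<and> Y \<omega> \<in> B} =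
      (\<integral>\<^sup>+ x\<in>A. emeasure (K x) B \<partial>distr M S X))"

definition half_half :: "real \<Rightarrow> real \<Rightarrow> real measure" where
  "half_half a b = measure_of UNIV (sets borel)
    (\<lambda>B. 1/2 * emeasure (return borel a) B + 1/2 * emeasure (return borel b) B)"

lemma sets_half_half [simp, measurable_cong]: "sets (half_half a b) = sets borel"
  unfolding half_half_def by (metis sets.sets_measure_of_eq space_borel)

lemma space_half_half [simp]: "space (half_half a b) = UNIV"
  by (simp add: half_half_def)

lemma emeasure_half_half:
  assumes "B \<in> sets borel"
  shows "emeasure (half_half a b) B =
    1/2 * emeasure (return borel a) B + 1/2 * emeasure (return borel b) B"
proof (rule emeasure_measure_of[OF half_half_def])
  show "countably_additive (sets (half_half a b))
    (\<lambda>B. 1/2 * emeasure (return borel a) B + 1/2 * emeasure (return borel b) B)"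
  proof (rule countably_additiveI)
    fix A :: "nat \<Rightarrow> real set"
    assume A: "range A \<subseteq> sets (half_half a b)" "disjoint_family A"
    have "(\<Sum>i. emeasure (return borel c) (A i)) = emeasure (return borel c) (\<Union>i. A i)"
      for c :: real
      using A by (intro suminf_emeasure) auto
    then show "(\<Sum>i. 1/2 * emeasure (return borel a) (A i) + 1/2 * emeasure (return borel b) (A i)) =
      1/2 * emeasure (return borel a) (\<Union>i. A i) + 1/2 * emeasure (return borel b) (\<Union>i. A i)"
      by (simp add: suminf_add[symmetric] ennreal_suminf_cmult del: emeasure_return)
  qed
qed (use assms in \<open>auto simp: positive_def\<close>)

lemma prob_space_half_half: "prob_space (half_half a b)"
proof
  have "1/2 + 1/2 = (1::ennreal)"
    by (simp flip: add_divide_distrib_ennreal)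
  then show "emeasure (half_half a b) (space (half_half a b)) = 1"
    by (simp add: emeasure_half_half)
qed

end

(* Mutual information is strictly concave in the output law, because of the equality case of Gibbs'
   inequality, and the output law determines the input law through its Laplace transform. Hence the
   maximizer P is unique and invariant under the sign changes of the coordinates, which preserve
   the ellipse and the noise.

   Let D(x) be the relative entropy of N(x, I) with respect to the output law of P. Perturbing P
   towards a point mass gives D <= I(P) on the ellipse, with equality P-almost everywhere. The
   Laplacian of D at x is the mean of 2 - tr Cov(X | Y = y) over y ~ N(x, I), which is at least the
   mean of 2 - E(|X|^2 | Y = y). For radii at most sqrt 2 this is positive as soon as P charges the
   interior of the ellipse, so D cannot attain its maximum at an interior point and P lives on the
   boundary. There x1 determines x2 up to sign, and the symmetry makes both signs equally likely. *)
theory Submission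
  imports Defs
begin

subsection \<open>Compactly supported measures are determined by their Laplace transform\<close>

text \<open>\<open>input_divergence\<close> is an integral of the logarithm of an integral, and
  differentiating it in the input or in a mixing weight would mean differentiating under both.
  Neither derivative is taken. For the mixing weight there is an exact identity: the information of
  a mixture is the mixture of the averages of its own divergence, and Gibbs' inequality bounds each
  average from below. This yields an inequality for every weight, and only a limit of weights
  tending to 0 remains. For the input, the Laplacian becomes a four-neighbour second difference with
  step \<open>t\<close>; its gain is of order \<open>t^2\<close>, its Taylor error of order
  \<open>t^4\<close>. The constant 2 is the dimension, the Laplacian of |x|^2 / 2, and |X|^2 \<le> 2
  is what radius \<open>sqrt 2\<close> guarantees. Compact support is used twice: the logarithm of
  the output density grows at most linearly, so the first moment of the noise dominates it, and
  spans of real exponentials are uniformly dense among continuous functions on the ball, which makes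
  the Laplace transform injective.\<close>

inductive_set exp_polynomials :: "('a::euclidean_space \<Rightarrow> real) set" where
  exp_mem: "(\<lambda>x. exp (t \<bullet> x)) \<in> exp_polynomials"
| add_mem: "f \<in> exp_polynomials \<Longrightarrow> g \<in> exp_polynomials \<Longrightarrow> (\<lambda>x. f x + g x) \<in> exp_polynomials"
| scale_mem: "f \<in> exp_polynomials \<Longrightarrow> (\<lambda>x. c * f x) \<in> exp_polynomials"

lemma continuous_on_exp_polynomials:
  assumes "f \<in> exp_polynomials"
  shows "continuous_on S f"
  using assms
proof induction
  case (exp_mem t)
  show ?case
    by (intro continuous_intros)
next
  case (add_mem f g)
  then show ?case
    by (intro continuous_on_add)
next
  case (scale_mem f c)
  then show ?case
    by (intro continuous_on_mult continuous_on_const)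
qed

lemma const_mem_exp_polynomials: "(\<lambda>_. c) \<in> exp_polynomials"
  using scale_mem[OF exp_mem[of 0], of c] by simp

lemma exp_mult_mem_exp_polynomials:
  assumes "g \<in> exp_polynomials"
  shows "(\<lambda>x. exp (t \<bullet> x) * g x) \<in> exp_polynomials"
  using assms
proof induction
  case (exp_mem s)
  then show ?case
    using exp_polynomials.exp_mem[of "t + s"] by (simp add: exp_add inner_add_left)
next
  case (add_mem f g)
  show ?case
    using exp_polynomials.add_mem[OF add_mem.IH] by (simp add: distrib_left)
next
  case (scale_mem f c)
  then show ?case
    using exp_polynomials.scale_mem[of "\<lambda>x. exp (t \<bullet> x) * f x" c]
    by (simp add: mult.left_commute)
qed

lemma mult_mem_exp_polynomials:
  assumes "f \<in> exp_polynomials" "g \<in> exp_polynomials"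
  shows "(\<lambda>x. f x * g x) \<in> exp_polynomials"
  using assms(1)
proof induction
  case (exp_mem t)
  show ?case
    using assms(2) by (rule exp_mult_mem_exp_polynomials)
next
  case (add_mem f1 f2)
  show ?case
    using exp_polynomials.add_mem[OF add_mem.IH] by (simp add: distrib_right)
next
  case (scale_mem f c)
  then show ?case
    using exp_polynomials.scale_mem[of "\<lambda>x. f x * g x" c] by (simp add: mult.assoc)
qed

text \<open>Exponentials multiply by adding frequencies, so their linear span is an algebra, and
  frequency 0 supplies the constants. This is the form in which Stone-Weierstrass takes its
  hypotheses.\<close>

lemma function_ring_on_exp_polynomials:
  assumes "compact S"
  shows "function_ring_on exp_polynomials S"
proof
  fix x y :: 'a
  assume "x \<noteq> y"
  \<comment> \<open>The frequency \<open>x - y\<close> separates the points: its inner products with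
    them differ by the squared norm of \<open>x - y\<close>.\<close>
  then have "(x - y) \<bullet> x \<noteq> (x - y) \<bullet> y"
    by (metis eq_iff_diff_eq_0 inner_diff_right inner_eq_zero_iff)
  then show "\<exists>f\<in>exp_polynomials. f x \<noteq> f y"
    using exp_mem[of "x - y"] by (intro bexI[of _ "\<lambda>z. exp ((x - y) \<bullet> z)"]) auto
next
  fix f g :: "'a \<Rightarrow> real"
  assume "f \<in> exp_polynomials" "g \<in> exp_polynomials"
  then show "(\<lambda>x. f x + g x) \<in> exp_polynomials" "(\<lambda>x. f x * g x) \<in> exp_polynomials"
    by (rule add_mem, rule mult_mem_exp_polynomials)
qed (fact assms continuous_on_exp_polynomials const_mem_exp_polynomials)+

lemma integrable_continuous_bounded_support:
  fixes M :: "'a::euclidean_space measure" and f :: "'a \<Rightarrow> real"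
  assumes "prob_space M" "sets M = sets borel" "AE x in M. norm x \<le> R" "continuous_on UNIV f"
  shows "integrable M f"
proof -
  interpret prob_space M by fact
  have "compact (f ` cball 0 R)"
    using assms(4) by (intro compact_continuous_image) (auto intro: continuous_on_subset)
  then have "bounded (f ` cball 0 R)"
    by (rule compact_imp_bounded)
  then obtain B where "\<forall>y\<in>f ` cball 0 R. norm y \<le> B"
    unfolding bounded_iff ..
  then have B: "norm (f x) \<le> B" if "norm x \<le> R" for x
    using that by simp
  have "f \<in> borel_measurable M"
    using borel_measurable_continuous_onI[OF assms(4)] assms(2) by (simp cong: measurable_cong_sets)
  then show ?thesis
    using assms(3) B by (intro integrable_const_bound[where B = B]) auto
qed

text \<open>Closed sets form an intersection-stable generator of the Borel sets, and the indicator
  of a closed set is a pointwise limit of continuous functions with values in [0, 1].\<close>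

lemma measure_eqI_continuous:
  fixes M N :: "'a::euclidean_space measure"
  assumes "prob_space M" "sets M = sets borel" "prob_space N" "sets N = sets borel"
    and eq: "\<And>f. continuous_on UNIV f \<Longrightarrow> (\<And>x. \<bar>f x\<bar> \<le> 1) \<Longrightarrow> (\<integral>x. f x \<partial>M) = (\<integral>x. f x \<partial>N :: real)"
  shows "M = N"
proof (rule measure_eqI_generator_eq)
  interpret M: prob_space M by fact
  interpret N: prob_space N by fact
  note [simp, measurable_cong] = assms(2,4)
  fix C :: "'a set"
  assume "C \<in> Collect closed"
  then have C: "closed C" by simp
  then have [measurable]: "C \<in> sets borel" by simp
  have "measure M C = measure N C"
  \<comment> \<open>The empty set is split off because \<open>infdist x {}\<close> is 0, so the
    functions below would be constantly 1.\<close>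
  proof (cases "C = {}")
    case False
    \<comment> \<open>Equal to 1 on \<open>C\<close>, decreasing with slope \<open>n\<close> in the
      distance to \<open>C\<close>, and 0 from distance \<open>1 / n\<close> on.\<close>
    define f where "f n x = max 0 (1 - real n * infdist x C)" for n x
    have cont: "continuous_on UNIV (f n)" for n
      unfolding f_def[abs_def] by (intro continuous_intros)
    have [measurable]: "f n \<in> borel_measurable borel" for n
      using cont by (rule borel_measurable_continuous_onI)
    have bound: "\<bar>f n x\<bar> \<le> 1" for n x
      by (simp add: f_def infdist_nonneg)
    have lim: "(\<lambda>n. f n x) \<longlonglongrightarrow> indicator C x" for x
    proof (cases "x \<in> C")
      case True
      then show ?thesis
        by (simp add: f_def)
    next
      case False
      with C \<open>C \<noteq> {}\<close> have "0 < infdist x C"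
        by (simp add: infdist_pos_not_in_closed)
      then obtain k where "1 < real k * infdist x C"
        using reals_Archimedean3 by blast
      then have "1 \<le> real n * infdist x C" if "k \<le> n" for n
        using that mult_right_mono[of "real k" "real n" "infdist x C"] infdist_nonneg[of x C]
        by simp
      then have "eventually (\<lambda>n. 1 \<le> real n * infdist x C) sequentially"
        by (rule eventually_sequentiallyI)
      then have "eventually (\<lambda>n. f n x = 0) sequentially"
        by eventually_elim (simp add: f_def)
      with False show ?thesis
        by (simp add: tendsto_eventually)
    qed
    have "(\<lambda>n. \<integral>x. f n x \<partial>M) \<longlonglongrightarrow> (\<integral>x. indicator C x \<partial>M)"
      by (rule integral_dominated_convergence[where w = "\<lambda>_. 1"]) (auto simp: lim bound)
    moreover have "(\<lambda>n. \<integral>x. f n x \<partial>N) \<longlonglongrightarrow> (\<integral>x. indicator C x \<partial>N)"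
      by (rule integral_dominated_convergence[where w = "\<lambda>_. 1"]) (auto simp: lim bound)
    moreover have "(\<integral>x. f n x \<partial>M) = (\<integral>x. f n x \<partial>N)" for n
      by (rule eq[OF cont bound])
    ultimately have "(\<integral>x. indicator C x \<partial>M) = (\<integral>x. indicator C x \<partial>N :: real)"
      by (simp add: LIMSEQ_unique)
    then show ?thesis
      by simp
  qed simp
  then show "emeasure M C = emeasure N C"
    by (simp add: M.emeasure_eq_measure N.emeasure_eq_measure)
next
  show "sets M = sigma_sets UNIV (Collect closed)" "sets N = sigma_sets UNIV (Collect closed)"
    using assms(2,4) by (simp_all add: borel_eq_closed)
  show "range (\<lambda>_::nat. UNIV) \<subseteq> Collect (closed :: 'a set \<Rightarrow> bool)"
    by simp
  show "emeasure M UNIV \<noteq> \<infinity>" for i :: nat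
    using prob_space.emeasure_le_1[OF assms(1), of UNIV] by (auto simp: top_unique)
qed (auto simp: Int_stable_def)

text \<open>Stone-Weierstrass approximates a continuous test function uniformly by
  \<open>exp_polynomials\<close> on the ball that carries both measures; the behaviour of the
  approximant outside is invisible to the integrals.\<close>

lemma measure_eqI_laplace:
  fixes M N :: "'a::euclidean_space measure"
  assumes M: "prob_space M" "sets M = sets borel" "AE x in M. norm x \<le> R"
    and N: "prob_space N" "sets N = sets borel" "AE x in N. norm x \<le> R"
    and eq: "\<And>t. (\<integral>x. exp (t \<bullet> x) \<partial>M) = (\<integral>x. exp (t \<bullet> x) \<partial>N)"
  shows "M = N"
proof (rule measure_eqI_continuous)
  interpret M: prob_space M by fact
  interpret N: prob_space N by fact
  note iM = integrable_continuous_bounded_support[OF M]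
  note iN = integrable_continuous_bounded_support[OF N]
  have poly: "(\<integral>x. g x \<partial>M) = (\<integral>x. g x \<partial>N)" if "g \<in> exp_polynomials" for g
    using that
    by induction (simp_all add: eq iM iN continuous_on_exp_polynomials)
  interpret function_ring_on exp_polynomials "cball 0 R :: 'a set"
    by (intro function_ring_on_exp_polynomials compact_cball)
  fix f :: "'a \<Rightarrow> real"
  assume f: "continuous_on UNIV f"
  have close: "\<bar>(\<integral>x. f x \<partial>K) - (\<integral>x. g x \<partial>K)\<bar> \<le> e"
    if K: "prob_space K" "sets K = sets borel" "AE x in K. norm x \<le> R"
      and g: "g \<in> exp_polynomials" "\<forall>x\<in>cball 0 R. \<bar>f x - g x\<bar> < e" for K g e
  proof -
    interpret K: prob_space K by fact
    note i = integrable_continuous_bounded_support[OF K]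
    have "\<bar>(\<integral>x. f x \<partial>K) - (\<integral>x. g x \<partial>K)\<bar> = \<bar>\<integral>x. f x - g x \<partial>K\<bar>"
      using i f g(1) by (simp add: continuous_on_exp_polynomials)
    also have "\<dots> \<le> (\<integral>x. \<bar>f x - g x\<bar> \<partial>K)"
      by (rule integral_abs_bound)
    also have "\<dots> \<le> e"
    proof (rule K.integral_le_const)
      show "integrable K (\<lambda>x. \<bar>f x - g x\<bar>)"
        using f continuous_on_exp_polynomials[OF g(1)] by (intro i continuous_intros)
      show "AE x in K. \<bar>f x - g x\<bar> \<le> e"
        using K(3) g(2) by (auto elim!: eventually_mono intro: less_imp_le)
    qed
    finally show ?thesis .
  qed
  \<comment> \<open>Each measure contributes an error \<open>e / 2\<close>. The summand 0 gives the
    bound the shape that \<open>field_le_epsilon\<close> expects.\<close>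
  have "\<bar>(\<integral>x. f x \<partial>M) - (\<integral>x. f x \<partial>N)\<bar> \<le> 0 + e" if "e > 0" for e
  proof -
    from that have "e / 2 > 0" by simp
    then obtain g where g: "g \<in> exp_polynomials" "\<forall>x\<in>cball 0 R. \<bar>f x - g x\<bar> < e / 2"
      using Stone_Weierstrass_basic[OF continuous_on_subset[OF f subset_UNIV]] by blast
    show ?thesis
      using close[OF M g] close[OF N g] poly[OF g(1)] by linarith
  qed
  then have "\<bar>(\<integral>x. f x \<partial>M) - (\<integral>x. f x \<partial>N)\<bar> \<le> 0"
    by (rule field_le_epsilon)
  then show "(\<integral>x. f x \<partial>M) = (\<integral>x. f x \<partial>N)"
    by simp
qed (fact assms)+

subsection \<open>The Gaussian noise\<close>

lemma borel_measurable_fst_snd [measurable]: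
  "fst \<in> borel_measurable (borel :: ('a::second_countable_topology \<times> 'b::second_countable_topology) measure)"
  "snd \<in> borel_measurable (borel :: ('a::second_countable_topology \<times> 'b::second_countable_topology) measure)"
  by (simp_all flip: borel_prod)

lemma sets_std_normal_plane [simp, measurable_cong]: "sets std_normal_plane = sets borel"
proof -
  have "sets std_normal_plane = sets (borel \<Otimes>\<^sub>M borel :: (real \<times> real) measure)"
    unfolding std_normal_plane_def by (intro sets_pair_measure_cong) auto
  then show ?thesis
    unfolding borel_prod .
qed

lemma space_std_normal_plane [simp]: "space std_normal_plane = UNIV"
  using sets_eq_imp_space_eq[OF sets_std_normal_plane] by simp

lemma prob_space_std_normal: "prob_space std_normal_distribution"
  by (rule prob_space_normal_density) simp

lemma prob_space_std_normal_plane: "prob_space std_normal_plane"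
proof -
  interpret N: prob_space std_normal_distribution by (rule prob_space_std_normal)
  interpret pair_prob_space std_normal_distribution std_normal_distribution ..
  show ?thesis
    unfolding std_normal_plane_def by (rule prob_space_axioms)
qed

interpretation \<gamma>: prob_space std_normal_plane
  by (rule prob_space_std_normal_plane)

lemma nn_integral_std_normal_plane:
  assumes [measurable]: "h \<in> borel_measurable borel"
  shows "(\<integral>\<^sup>+z. h z \<partial>std_normal_plane) =
    (\<integral>\<^sup>+u. \<integral>\<^sup>+v. h (u, v) \<partial>std_normal_distribution \<partial>std_normal_distribution)"
proof -
  interpret N: prob_space std_normal_distribution by (rule prob_space_std_normal)
  have "h \<in> borel_measurable (std_normal_distribution \<Otimes>\<^sub>M std_normal_distribution)"
    using assms sets_std_normal_plane unfolding std_normal_plane_def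
    by (simp cong: measurable_cong_sets)
  then show ?thesis
    unfolding std_normal_plane_def by (simp add: N.nn_integral_fst)
qed

text \<open>The likelihood ratio of N(x, I) to N(0, I) at \<open>y\<close>. The general inner
  product space lets one function serve on the line and in the plane.\<close>

definition tilt :: "'a::real_inner \<Rightarrow> 'a \<Rightarrow> real" where
  "tilt x y = exp (x \<bullet> y - x \<bullet> x / 2)"

lemma tilt_pos [simp]: "0 < tilt x y" "0 \<le> tilt x y" "tilt x y \<noteq> 0"
  by (simp_all add: tilt_def less_imp_le)

lemma borel_measurable_tilt [measurable]:
  fixes f g :: "'b \<Rightarrow> 'a::{second_countable_topology, real_inner}"
  assumes [measurable]: "f \<in> borel_measurable M" "g \<in> borel_measurable M"
  shows "(\<lambda>w. tilt (f w) (g w)) \<in> borel_measurable M"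
  unfolding tilt_def by measurable

text \<open>Together with \<open>tilt_ge\<close> this is uniform over inputs in the ball, so both
  bounds pass to averages over the input and give the log-density of the output linear growth in
  \<open>norm y\<close>.\<close>

lemma tilt_le:
  assumes "norm x \<le> R"
  shows "tilt x y \<le> exp (R * norm y)"
proof -
  have "x \<bullet> y \<le> norm x * norm y"
    by (rule norm_cauchy_schwarz)
  also have "\<dots> \<le> R * norm y"
    using assms by (simp add: mult_right_mono)
  finally have "x \<bullet> y - x \<bullet> x / 2 \<le> R * norm y"
    using inner_ge_zero[of x] by linarith
  then show ?thesis
    by (simp add: tilt_def)
qed

lemma tilt_ge:
  assumes "norm x \<le> R"
  shows "exp (- (R * norm y) - R\<^sup>2 / 2) \<le> tilt x y"
proof -
  have "- (norm x * norm y) \<le> x \<bullet> y"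
    using norm_cauchy_schwarz[of "- x" y] by simp
  moreover have "norm x * norm y \<le> R * norm y"
    using assms by (simp add: mult_right_mono)
  moreover have "x \<bullet> x \<le> R\<^sup>2"
    using assms by (simp add: dot_square_norm power_mono)
  ultimately have "- (R * norm y) - R\<^sup>2 / 2 \<le> x \<bullet> y - x \<bullet> x / 2"
    by simp
  then show ?thesis
    by (simp add: tilt_def)
qed

text \<open>Translating Lebesgue measure moves the shift into the Gaussian density; expanding the
  square there leaves the original density times \<open>tilt\<close>.\<close>

lemma nn_integral_std_normal_shift:
  fixes a :: real
  assumes [measurable]: "h \<in> borel_measurable borel"
  shows "(\<integral>\<^sup>+z. h (a + z) \<partial>std_normal_distribution) =
    (\<integral>\<^sup>+z. ennreal (tilt a z) * h z \<partial>std_normal_distribution)"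
proof -
  have eq: "std_normal_density (y - a) = std_normal_density y * tilt a y" for y :: real
    by (simp add: std_normal_density_def tilt_def flip: exp_add)
       (simp add: power2_eq_square field_simps)
  have "(\<integral>\<^sup>+z. h (a + z) \<partial>std_normal_distribution) =
      (\<integral>\<^sup>+z. ennreal (std_normal_density z) * h (a + z) \<partial>lborel)"
    by (simp add: nn_integral_density)
  also have "\<dots> = (\<integral>\<^sup>+y. ennreal (std_normal_density (- a + y)) * h y \<partial>lborel)"
    by (subst nn_integral_real_affine[where c = 1 and t = "- a"]) simp_all
  also have "\<dots> = (\<integral>\<^sup>+y. ennreal (std_normal_density y) * (ennreal (tilt a y) * h y) \<partial>lborel)"
    by (simp add: eq ennreal_mult mult.assoc)
  also have "\<dots> = (\<integral>\<^sup>+z. ennreal (tilt a z) * h z \<partial>std_normal_distribution)"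
    by (simp add: nn_integral_density)
  finally show ?thesis .
qed

text \<open>\<open>tilt\<close> factorises over the coordinates, so the one-dimensional shift is
  applied to the inner and then to the outer integral.\<close>

lemma nn_integral_std_normal_plane_shift:
  assumes h [measurable]: "h \<in> borel_measurable borel"
  shows "(\<integral>\<^sup>+z. h (x + z) \<partial>std_normal_plane) =
    (\<integral>\<^sup>+z. ennreal (tilt x z) * h z \<partial>std_normal_plane)"
proof -
  obtain a b where x: "x = (a, b)"
    by force
  interpret N: prob_space std_normal_distribution by (rule prob_space_std_normal)
  have [measurable]: "h \<in> borel_measurable (borel \<Otimes>\<^sub>M borel)"
    by (simp add: borel_prod)
  have tilt: "tilt (a, b) (u, v) = tilt a u * tilt b v" for u v
    by (simp add: tilt_def field_simps flip: exp_add)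
  have "(\<integral>\<^sup>+z. h (x + z) \<partial>std_normal_plane) =
      (\<integral>\<^sup>+u. \<integral>\<^sup>+v. h (a + u, b + v) \<partial>std_normal_distribution \<partial>std_normal_distribution)"
    by (simp add: x nn_integral_std_normal_plane)
  also have "\<dots> = (\<integral>\<^sup>+u. \<integral>\<^sup>+v. ennreal (tilt b v) * h (a + u, v)
      \<partial>std_normal_distribution \<partial>std_normal_distribution)"
    by (subst nn_integral_std_normal_shift[where a = b]) simp_all
  also have "\<dots> = (\<integral>\<^sup>+u. ennreal (tilt a u) * (\<integral>\<^sup>+v. ennreal (tilt b v) * h (u, v)
      \<partial>std_normal_distribution) \<partial>std_normal_distribution)"
    by (rule nn_integral_std_normal_shift) simp
  also have "\<dots> = (\<integral>\<^sup>+z. ennreal (tilt x z) * h z \<partial>std_normal_plane)"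
    by (simp add: nn_integral_std_normal_plane x tilt ennreal_mult mult.assoc nn_integral_cmult)
  finally show ?thesis .
qed

lemma nn_integral_tilt: "(\<integral>\<^sup>+z. ennreal (tilt x z) \<partial>std_normal_plane) = 1"
  using nn_integral_std_normal_plane_shift[of "\<lambda>_. 1" x] by (simp add: \<gamma>.emeasure_space_1[simplified])

lemma distr_std_normal_uminus: "distr std_normal_distribution borel uminus = std_normal_distribution"
proof (rule measure_eqI)
  fix A :: "real set"
  assume "A \<in> sets (distr std_normal_distribution borel uminus)"
  then have [measurable]: "A \<in> sets borel" by simp
  have "emeasure (distr std_normal_distribution borel uminus) A =
      (\<integral>\<^sup>+z. indicator A z \<partial>distr std_normal_distribution borel uminus)"
    by simp
  also have "\<dots> = (\<integral>\<^sup>+z. indicator A (- z) \<partial>std_normal_distribution)"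
    by (rule nn_integral_distr) simp_all
  also have "\<dots> = (\<integral>\<^sup>+z. ennreal (std_normal_density z) * indicator A (- z) \<partial>lborel)"
    by (simp add: nn_integral_density)
  also have "\<dots> = (\<integral>\<^sup>+z. ennreal (std_normal_density z) * indicator A z \<partial>lborel)"
    by (subst nn_integral_real_affine[where c = "- 1" and t = 0]) (simp_all add: std_normal_density_def)
  finally show "emeasure (distr std_normal_distribution borel uminus) A = emeasure std_normal_distribution A"
    by (simp add: emeasure_density)
qed simp

lemma integrable_norm_std_normal_plane: "integrable std_normal_plane norm"
proof (rule integrableI_bounded)
  interpret N: prob_space std_normal_distribution by (rule prob_space_std_normal)
  let ?N = std_normal_distribution
  have fin: "(\<integral>\<^sup>+z. ennreal \<bar>z\<bar> \<partial>?N) < \<infinity>"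
    using integrable_std_normal_distribution_moment[of 1]
    by (simp add: integrable_iff_bounded)
  have "(\<integral>\<^sup>+z. ennreal (norm (norm z)) \<partial>std_normal_plane) \<le>
      (\<integral>\<^sup>+z. ennreal \<bar>fst z\<bar> + ennreal \<bar>snd z\<bar> \<partial>std_normal_plane)"
  proof (rule nn_integral_mono)
    fix z :: "real \<times> real"
    have "norm z \<le> \<bar>fst z\<bar> + \<bar>snd z\<bar>"
      using norm_Pair_le[of "fst z" "snd z"] by simp
    then show "ennreal (norm (norm z)) \<le> ennreal \<bar>fst z\<bar> + ennreal \<bar>snd z\<bar>"
      by (simp flip: ennreal_plus)
  qed
  also have "\<dots> = (\<integral>\<^sup>+u. ennreal \<bar>u\<bar> \<partial>?N) + (\<integral>\<^sup>+v. ennreal \<bar>v\<bar> \<partial>?N)"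
    by (subst nn_integral_std_normal_plane)
       (simp_all add: nn_integral_add N.emeasure_space_1[simplified])
  also have "\<dots> < \<infinity>"
    using fin by simp
  finally show "(\<integral>\<^sup>+z. ennreal (norm (norm z)) \<partial>std_normal_plane) < \<infinity>" .
qed simp

subsection \<open>The output density and the information density\<close>

text \<open>All densities are taken with respect to the noise law, not Lebesgue measure: \<open>tilt x\<close> is the
  density of the noise law shifted by \<open>x\<close> (Cameron--Martin). The quantity \<open>input_divergence P x\<close> is
  the relative entropy of the output law given input \<open>x\<close> with respect to the output law of \<open>P\<close>.\<close>

definition out_density :: "(real \<times> real) measure \<Rightarrow> real \<times> real \<Rightarrow> real" where
  "out_density P y = (\<integral>x. tilt x y \<partial>P)"

definition input_divergence :: "(real \<times> real) measure \<Rightarrow> real \<times> real \<Rightarrow> real" where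
  "input_divergence P x = x \<bullet> x / 2 - (\<integral>z. ln (out_density P (x + z)) \<partial>std_normal_plane)"

text \<open>The radius is a parameter detached from the ellipse, so that one law can also be viewed
  in a larger ball.\<close>

locale bounded_input = prob_space P
  for P :: "(real \<times> real) measure" +
  fixes R :: real
  assumes sets_P [simp, measurable_cong]: "sets P = sets borel"
    and bounded: "AE x in P. norm x \<le> R"
begin

sublocale input_noise: pair_prob_space P std_normal_plane ..

lemma space_P [simp]: "space P = UNIV"
  using sets_eq_imp_space_eq[OF sets_P] by simp

lemma R_nonneg: "0 \<le> R"
proof -
  obtain x :: "real \<times> real" where "norm x \<le> R"
    using bounded AE_False by (metis (mono_tags, lifting) eventually_mono)
  then show ?thesis
    using norm_ge_zero order_trans by blast
qed

lemma integrable_tilt: "integrable P (\<lambda>x. tilt x y)"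
  using bounded
  by (intro integrable_const_bound[where B = "exp (R * norm y)"]) (auto simp: tilt_le)

lemma out_density_le: "out_density P y \<le> exp (R * norm y)"
  unfolding out_density_def
  using bounded by (intro integral_le_const integrable_tilt) (auto simp: tilt_le)

lemma out_density_ge: "exp (- (R * norm y) - R\<^sup>2 / 2) \<le> out_density P y"
  unfolding out_density_def
  using bounded by (intro integral_ge_const integrable_tilt) (auto intro: tilt_ge)

lemma out_density_pos [simp]: "0 < out_density P y" "0 \<le> out_density P y" "out_density P y \<noteq> 0"
  using out_density_ge[of y] exp_gt_zero[of "- (R * norm y) - R\<^sup>2 / 2"] by linarith+

lemma ennreal_out_density: "ennreal (out_density P y) = (\<integral>\<^sup>+x. ennreal (tilt x y) \<partial>P)"
  unfolding out_density_def by (intro nn_integral_eq_integral[symmetric] integrable_tilt) simp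

lemma borel_measurable_out_density [measurable]: "out_density P \<in> borel_measurable borel"
  unfolding out_density_def[abs_def] by measurable

lemma abs_ln_out_density_le: "\<bar>ln (out_density P y)\<bar> \<le> R * norm y + R\<^sup>2 / 2"
proof -
  have "ln (out_density P y) \<le> R * norm y"
    using out_density_le[of y] ln_le_cancel_iff[of "out_density P y" "exp (R * norm y)"] by simp
  moreover have "- (R * norm y) - R\<^sup>2 / 2 \<le> ln (out_density P y)"
    using out_density_ge[of y] by (simp add: ln_ge_iff)
  moreover have "0 \<le> R * norm y"
    using R_nonneg by simp
  ultimately show ?thesis
    using zero_le_power2[of R] by (simp only: abs_le_iff) linarith
qed

text \<open>The shift formula in the inner integral exhibits \<open>tilt\<close> as the density of
  the joint law of input and output with respect to input law times noise law.\<close>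

lemma nn_integral_joint:
  assumes [measurable]: "h \<in> borel_measurable (borel \<Otimes>\<^sub>M borel)"
  shows "(\<integral>\<^sup>+(x, z). h (x, x + z) \<partial>(P \<Otimes>\<^sub>M std_normal_plane)) =
    (\<integral>\<^sup>+x. \<integral>\<^sup>+y. ennreal (tilt x y) * h (x, y) \<partial>std_normal_plane \<partial>P)"
proof -
  have "(\<integral>\<^sup>+(x, z). h (x, x + z) \<partial>(P \<Otimes>\<^sub>M std_normal_plane)) =
      (\<integral>\<^sup>+x. \<integral>\<^sup>+z. h (x, x + z) \<partial>std_normal_plane \<partial>P)"
    by (subst \<gamma>.nn_integral_fst[symmetric]) simp_all
  also have "\<dots> = (\<integral>\<^sup>+x. \<integral>\<^sup>+y. ennreal (tilt x y) * h (x, y) \<partial>std_normal_plane \<partial>P)"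
    by (intro nn_integral_cong nn_integral_std_normal_plane_shift) measurable
  finally show ?thesis .
qed

lemma nn_integral_output:
  assumes [measurable]: "h \<in> borel_measurable borel"
  shows "(\<integral>\<^sup>+(x, z). h (x + z) \<partial>(P \<Otimes>\<^sub>M std_normal_plane)) =
    (\<integral>\<^sup>+y. ennreal (out_density P y) * h y \<partial>std_normal_plane)"
proof -
  have "(\<integral>\<^sup>+(x, z). h (x + z) \<partial>(P \<Otimes>\<^sub>M std_normal_plane)) =
      (\<integral>\<^sup>+x. \<integral>\<^sup>+y. ennreal (tilt x y) * h y \<partial>std_normal_plane \<partial>P)"
    using nn_integral_joint[of "\<lambda>w. h (snd w)"] by simp
  also have "\<dots> = (\<integral>\<^sup>+y. \<integral>\<^sup>+x. ennreal (tilt x y) * h y \<partial>P \<partial>std_normal_plane)"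
    by (intro input_noise.Fubini'[symmetric]) measurable
  also have "\<dots> = (\<integral>\<^sup>+y. ennreal (out_density P y) * h y \<partial>std_normal_plane)"
    by (simp add: ennreal_out_density nn_integral_multc)
  finally show ?thesis .
qed

lemma distr_output:
  "distr (P \<Otimes>\<^sub>M std_normal_plane) borel (\<lambda>(x, z). x + z) =
    density std_normal_plane (\<lambda>y. ennreal (out_density P y))"
proof (rule measure_eqI)
  fix A :: "(real \<times> real) set"
  assume "A \<in> sets (distr (P \<Otimes>\<^sub>M std_normal_plane) borel (\<lambda>(x, z). x + z))"
  then have [measurable]: "A \<in> sets borel" by simp
  have "emeasure (distr (P \<Otimes>\<^sub>M std_normal_plane) borel (\<lambda>(x, z). x + z)) A =
      (\<integral>\<^sup>+y. indicator A y \<partial>distr (P \<Otimes>\<^sub>M std_normal_plane) borel (\<lambda>(x, z). x + z))"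
    by simp
  also have "\<dots> = (\<integral>\<^sup>+w. indicator A (case w of (x, z) \<Rightarrow> x + z) \<partial>(P \<Otimes>\<^sub>M std_normal_plane))"
    by (rule nn_integral_distr) measurable
  also have "\<dots> = (\<integral>\<^sup>+y. ennreal (out_density P y) * indicator A y \<partial>std_normal_plane)"
    using nn_integral_output[of "indicator A"] by (simp add: split_beta')
  finally show "emeasure (distr (P \<Otimes>\<^sub>M std_normal_plane) borel (\<lambda>(x, z). x + z)) A =
      emeasure (density std_normal_plane (\<lambda>y. ennreal (out_density P y))) A"
    by (simp add: emeasure_density)
qed simp

lemma prob_space_output: "prob_space (density std_normal_plane (\<lambda>y. ennreal (out_density P y)))"
  unfolding distr_output[symmetric] by (rule input_noise.P.prob_space_distr) measurable

text \<open>Mutual information compares the joint law with the product of its marginals, so the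
  density is renormalised from the noise law to the output law.\<close>

lemma distr_joint:
  "distr (P \<Otimes>\<^sub>M std_normal_plane) (borel \<Otimes>\<^sub>M borel) (\<lambda>(x, z). (x, x + z)) =
    density (P \<Otimes>\<^sub>M density std_normal_plane (\<lambda>y. ennreal (out_density P y)))
      (\<lambda>(x, y). ennreal (tilt x y / out_density P y))"
    (is "?J = density (P \<Otimes>\<^sub>M ?Y) ?f")
proof (rule measure_eqI)
  interpret Y: prob_space ?Y by (rule prob_space_output)
  show "sets ?J = sets (density (P \<Otimes>\<^sub>M ?Y) ?f)"
    by (simp cong: sets_pair_measure_cong)
  fix A :: "((real \<times> real) \<times> (real \<times> real)) set"
  assume "A \<in> sets ?J"
  then have [measurable]: "A \<in> sets (borel \<Otimes>\<^sub>M borel)" by simp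
  have [measurable]: "A \<in> sets (P \<Otimes>\<^sub>M ?Y)"
    by (simp cong: sets_pair_measure_cong)
  have "emeasure ?J A = (\<integral>\<^sup>+y. indicator A y \<partial>?J)"
    by simp
  also have "\<dots> = (\<integral>\<^sup>+w. indicator A (case w of (x, z) \<Rightarrow> (x, x + z)) \<partial>(P \<Otimes>\<^sub>M std_normal_plane))"
    by (rule nn_integral_distr) measurable
  also have "\<dots> = (\<integral>\<^sup>+x. \<integral>\<^sup>+y. ennreal (tilt x y) * indicator A (x, y) \<partial>std_normal_plane \<partial>P)"
    using nn_integral_joint[of "indicator A"] by (simp add: split_beta')
  also have "\<dots> = (\<integral>\<^sup>+x. \<integral>\<^sup>+y. ennreal (out_density P y) *
      (ennreal (tilt x y / out_density P y) * indicator A (x, y)) \<partial>std_normal_plane \<partial>P)"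
    by (simp add: mult.assoc[symmetric] flip: ennreal_mult)
  also have "\<dots> = (\<integral>\<^sup>+x. \<integral>\<^sup>+y. ennreal (tilt x y / out_density P y) * indicator A (x, y) \<partial>?Y \<partial>P)"
    by (intro nn_integral_cong nn_integral_density[symmetric]) measurable
  also have "\<dots> = (\<integral>\<^sup>+w. ?f w * indicator A w \<partial>(P \<Otimes>\<^sub>M ?Y))"
    by (subst Y.nn_integral_fst[symmetric]) simp_all
  also have "\<dots> = emeasure (density (P \<Otimes>\<^sub>M ?Y) ?f) A"
    by (simp add: emeasure_density)
  finally show "emeasure ?J A = emeasure (density (P \<Otimes>\<^sub>M ?Y) ?f) A" .
qed

lemma ln_tilt_div_out_density:
  "ln (tilt x y / out_density P y) = x \<bullet> y - x \<bullet> x / 2 - ln (out_density P y)"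
  by (simp add: ln_div) (simp add: tilt_def)

lemma channel_information_eq_pair:
  "channel_information P =
    (\<integral>(x, z). x \<bullet> z + x \<bullet> x / 2 - ln (out_density P (x + z)) \<partial>(P \<Otimes>\<^sub>M std_normal_plane))"
proof -
  let ?\<gamma> = std_normal_plane
  let ?Y = "density ?\<gamma> (\<lambda>y. ennreal (out_density P y))"
  let ?f = "\<lambda>w. tilt (fst w) (snd w) / out_density P (snd w)"
  interpret Y: prob_space ?Y by (rule prob_space_output)
  interpret PY: pair_prob_space P ?Y ..
  have X: "distr (P \<Otimes>\<^sub>M ?\<gamma>) borel (\<lambda>(x, z). x) = P"
    using \<gamma>.distr_pair_fst[of P] by (simp add: fst_def cong: distr_cong)
  have J: "distr (P \<Otimes>\<^sub>M ?\<gamma>) (borel \<Otimes>\<^sub>M borel) (\<lambda>(x, z). (x, x + z)) =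
      density (P \<Otimes>\<^sub>M ?Y) (\<lambda>w. ennreal (?f w))"
    using distr_joint by (simp add: split_beta')
  have "channel_information P = KL_divergence (exp 1) (P \<Otimes>\<^sub>M ?Y) (density (P \<Otimes>\<^sub>M ?Y) (\<lambda>w. ennreal (?f w)))"
    unfolding channel_information_def input_noise.P.mutual_information_def X distr_output J[symmetric]
    by (simp add: split_beta')
  also have "\<dots> = (\<integral>w. ?f w * ln (?f w) \<partial>(P \<Otimes>\<^sub>M ?Y))"
    by (subst PY.P.KL_density) (simp_all add: log_def)
  \<comment> \<open>One factor \<open>?f\<close> is absorbed into the measure, which turns it back
    into the joint law; pulling back to input and noise then makes the integrand explicit.\<close>
  also have "\<dots> = (\<integral>w. ln (?f w) \<partial>(density (P \<Otimes>\<^sub>M ?Y) (\<lambda>w. ennreal (?f w))))"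
    by (subst integral_density) simp_all
  also have "\<dots> = (\<integral>(x, z). ln (?f (x, x + z)) \<partial>(P \<Otimes>\<^sub>M ?\<gamma>))"
    unfolding J[symmetric] by (subst integral_distr) (simp_all add: split_beta')
  also have "\<dots> = (\<integral>(x, z). x \<bullet> z + x \<bullet> x / 2 - ln (out_density P (x + z)) \<partial>(P \<Otimes>\<^sub>M ?\<gamma>))"
    by (simp only: fst_conv snd_conv ln_tilt_div_out_density inner_add_right) (simp add: field_simps)
  finally show ?thesis .
qed

end

text \<open>Used with \<open>a\<close> and \<open>b\<close> equal to 1 or -1:
  \<open>reflect (- 1) (- 1)\<close> is negation, \<open>reflect 1 (- 1)\<close> flips the second
  coordinate only.\<close>

definition reflect :: "real \<Rightarrow> real \<Rightarrow> real \<times> real \<Rightarrow> real \<times> real" where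
  "reflect a b z = (a * fst z, b * snd z)"

lemma borel_measurable_reflect [measurable]: "reflect a b \<in> borel_measurable borel"
proof -
  have "reflect a b \<in> borel \<rightarrow>\<^sub>M borel \<Otimes>\<^sub>M borel"
    unfolding reflect_def[abs_def] by measurable
  then show ?thesis
    by (simp add: borel_prod)
qed

lemma reflect_add: "reflect a b (x + z) = reflect a b x + reflect a b z"
  by (simp add: reflect_def algebra_simps)

lemma distr_std_normal_plane_reflect:
  assumes "\<bar>a\<bar> = 1" "\<bar>b\<bar> = 1"
  shows "distr std_normal_plane borel (reflect a b) = std_normal_plane"
proof -
  let ?N = std_normal_distribution
  have N: "distr ?N borel ((*) c) = ?N" if "\<bar>c\<bar> = 1" for c :: real
  proof (cases "c = 1")
    case True
    then have "distr ?N borel ((*) c) = distr ?N ?N (\<lambda>x. x)"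
      by (intro distr_cong) auto
    then show ?thesis
      by simp
  next
    case False
    with that have "c = - 1"
      by linarith
    then have "distr ?N borel ((*) c) = distr ?N borel uminus"
      by (intro distr_cong) auto
    then show ?thesis
      by (simp add: distr_std_normal_uminus)
  qed
  have "std_normal_plane = distr ?N borel ((*) a) \<Otimes>\<^sub>M distr ?N borel ((*) b)"
    using assms by (simp add: N std_normal_plane_def)
  also have "\<dots> = distr (?N \<Otimes>\<^sub>M ?N) (borel \<Otimes>\<^sub>M borel) (\<lambda>(u, v). (a * u, b * v))"
    using prob_space_std_normal assms
    by (intro pair_measure_distr) (auto simp: N intro: prob_space_imp_sigma_finite)
  also have "\<dots> = distr std_normal_plane borel (reflect a b)"
    by (simp add: std_normal_plane_def reflect_def[abs_def] borel_prod split_beta')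
  finally show ?thesis
    by simp
qed

lemma integrable_inner_std_normal_plane: "integrable std_normal_plane (\<lambda>z. x \<bullet> z)"
proof (rule Bochner_Integration.integrable_bound)
  show "integrable std_normal_plane (\<lambda>z. norm x * norm z)"
    using integrable_norm_std_normal_plane by simp
qed (auto simp: Cauchy_Schwarz_ineq2)

lemma integral_inner_std_normal_plane: "(\<integral>z. x \<bullet> z \<partial>std_normal_plane) = 0"
proof -
  have r: "reflect (- 1) (- 1) z = - z" for z
    by (simp add: reflect_def prod_eq_iff)
  have "(\<integral>z. x \<bullet> z \<partial>std_normal_plane) =
      (\<integral>z. x \<bullet> z \<partial>distr std_normal_plane borel (reflect (- 1) (- 1)))"
    by (simp add: distr_std_normal_plane_reflect)
  also have "\<dots> = (\<integral>z. x \<bullet> reflect (- 1) (- 1) z \<partial>std_normal_plane)"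
    by (rule integral_distr) measurable
  also have "\<dots> = - (\<integral>z. x \<bullet> z \<partial>std_normal_plane)"
    by (simp add: r)
  finally show ?thesis
    by simp
qed

section \<open>Information as an average of divergences, and Gibbs' inequality\<close>

context bounded_input
begin

lemma integrable_ln_out_density:
  "integrable std_normal_plane (\<lambda>z. ln (out_density P (x + z)))"
proof (rule Bochner_Integration.integrable_bound)
  show "integrable std_normal_plane (\<lambda>z. R * norm x + R * norm z + R\<^sup>2 / 2)"
    using integrable_norm_std_normal_plane by simp
  show "AE z in std_normal_plane. norm (ln (out_density P (x + z)))
      \<le> norm (R * norm x + R * norm z + R\<^sup>2 / 2)"
  proof (rule AE_I2)
    fix z
    have "R * norm (x + z) \<le> R * (norm x + norm z)"
      using R_nonneg norm_triangle_ineq by (intro mult_left_mono)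
    then show "norm (ln (out_density P (x + z))) \<le> norm (R * norm x + R * norm z + R\<^sup>2 / 2)"
      using abs_ln_out_density_le[of "x + z"] by (simp add: distrib_left)
  qed
qed simp

text \<open>At the output \<open>x + z\<close> the logarithm of \<open>tilt x\<close> is
  \<open>x \<bullet> z + x \<bullet> x / 2\<close>, and the linear term has mean zero. So the closed
  form in the definition is an expected log-likelihood ratio.\<close>

lemma input_divergence_eq:
  "input_divergence P x =
    (\<integral>z. x \<bullet> z + x \<bullet> x / 2 - ln (out_density P (x + z)) \<partial>std_normal_plane)"
  unfolding input_divergence_def
  by (simp add: integrable_inner_std_normal_plane integrable_ln_out_density
      integral_inner_std_normal_plane \<gamma>.prob_space[simplified])

lemma integrable_norm_noise: "integrable (P \<Otimes>\<^sub>M std_normal_plane) (\<lambda>(x, z). norm z)"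
  using integrable_norm_std_normal_plane by (intro input_noise.Fubini_integrable) auto

lemma AE_norm_input: "AE w in P \<Otimes>\<^sub>M std_normal_plane. norm (fst w) \<le> R"
proof (rule input_noise.AE_pair_measure)
  show "{w \<in> space (P \<Otimes>\<^sub>M std_normal_plane). norm (fst w) \<le> R} \<in> sets (P \<Otimes>\<^sub>M std_normal_plane)"
    by measurable
  show "AE x in P. AE z in std_normal_plane. norm (fst (x, z)) \<le> R"
    using bounded by simp
qed

text \<open>The input is drawn from one law and the log-density belongs to another: this is the
  cross term in Gibbs' inequality.\<close>

lemma integrable_ln_out_density_pair:
  assumes "bounded_input Q S"
  shows "integrable (P \<Otimes>\<^sub>M std_normal_plane) (\<lambda>(x, z). ln (out_density Q (x + z)))"
proof (rule Bochner_Integration.integrable_bound)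
  interpret Q: bounded_input Q S by fact
  show "integrable (P \<Otimes>\<^sub>M std_normal_plane) (\<lambda>(x, z). S * R + S * norm z + S\<^sup>2 / 2)"
    using integrable_norm_noise by (simp add: split_beta')
  show "AE w in P \<Otimes>\<^sub>M std_normal_plane. norm (case w of (x, z) \<Rightarrow> ln (out_density Q (x + z)))
      \<le> norm (case w of (x, z) \<Rightarrow> S * R + S * norm z + S\<^sup>2 / 2)"
    using AE_norm_input
  proof eventually_elim
    case (elim w)
    obtain x z where w: "w = (x, z)" by (cases w)
    have "S * norm (x + z) \<le> S * (R + norm z)"
      using Q.R_nonneg norm_triangle_ineq[of x z] elim w by (intro mult_left_mono) auto
    then show ?case
      using Q.abs_ln_out_density_le[of "x + z"] by (simp add: w distrib_left)
  qed
  show "(\<lambda>(x, z). ln (out_density Q (x + z))) \<in> borel_measurable (P \<Otimes>\<^sub>M std_normal_plane)"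
    by measurable
qed

lemma integrable_info_pair:
  assumes "bounded_input Q S"
  shows "integrable (P \<Otimes>\<^sub>M std_normal_plane)
    (\<lambda>(x, z). x \<bullet> z + x \<bullet> x / 2 - ln (out_density Q (x + z)))"
proof -
  have "integrable (P \<Otimes>\<^sub>M std_normal_plane) (\<lambda>w. fst w \<bullet> snd w)"
  proof (rule Bochner_Integration.integrable_bound)
    show "integrable (P \<Otimes>\<^sub>M std_normal_plane) (\<lambda>(x, z). R * norm z)"
      using integrable_norm_noise by (simp add: split_beta')
    show "AE w in P \<Otimes>\<^sub>M std_normal_plane. norm (fst w \<bullet> snd w)
        \<le> norm (case w of (x, z) \<Rightarrow> R * norm z)"
      using AE_norm_input
    proof eventually_elim
      case (elim w)
      have "\<bar>fst w \<bullet> snd w\<bar> \<le> norm (fst w) * norm (snd w)"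
        by (rule Cauchy_Schwarz_ineq2)
      also have "\<dots> \<le> R * norm (snd w)"
        using elim by (intro mult_right_mono) auto
      finally show ?case
        using R_nonneg by (simp add: split_beta' abs_mult)
    qed
  qed measurable
  moreover have "integrable (P \<Otimes>\<^sub>M std_normal_plane) (\<lambda>w. fst w \<bullet> fst w / 2)"
  proof (rule input_noise.P.integrable_const_bound)
    show "AE w in P \<Otimes>\<^sub>M std_normal_plane. norm (fst w \<bullet> fst w / 2) \<le> R\<^sup>2 / 2"
      using AE_norm_input
      by eventually_elim (simp add: dot_square_norm power_mono)
  qed measurable
  ultimately show ?thesis
    using integrable_ln_out_density_pair[OF assms] by (simp add: split_beta')
qed

lemma integral_input_divergence:
  assumes "bounded_input Q S"
  shows "(\<integral>x. input_divergence Q x \<partial>P) =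
      (\<integral>(x, z). x \<bullet> z + x \<bullet> x / 2 - ln (out_density Q (x + z)) \<partial>(P \<Otimes>\<^sub>M std_normal_plane))"
    and "integrable P (input_divergence Q)"
proof -
  interpret Q: bounded_input Q S by fact
  show "(\<integral>x. input_divergence Q x \<partial>P) =
      (\<integral>(x, z). x \<bullet> z + x \<bullet> x / 2 - ln (out_density Q (x + z)) \<partial>(P \<Otimes>\<^sub>M std_normal_plane))"
    using input_noise.integral_fst'[OF integrable_info_pair[OF assms]]
    by (simp add: Q.input_divergence_eq)
  show "integrable P (input_divergence Q)"
    using input_noise.integrable_fst'[OF integrable_info_pair[OF assms]]
    by (simp add: Q.input_divergence_eq[abs_def])
qed

lemma channel_information_eq: "channel_information P = (\<integral>x. input_divergence P x \<partial>P)"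
  using bounded_input_axioms by (simp add: channel_information_eq_pair integral_input_divergence(1))

lemma integrable_out_density: "integrable std_normal_plane (out_density P)"
  and integral_out_density: "(\<integral>y. out_density P y \<partial>std_normal_plane) = 1"
proof -
  have *: "(\<integral>\<^sup>+y. ennreal (out_density P y) \<partial>std_normal_plane) = 1"
    using nn_integral_output[of "\<lambda>_. 1"] input_noise.P.emeasure_space_1
    by (simp add: split_beta')
  then show "integrable std_normal_plane (out_density P)"
    by (intro integrableI_nonneg) auto
  then show "(\<integral>y. out_density P y \<partial>std_normal_plane) = 1"
    using * by (simp add: nn_integral_eq_integral)
qed

text \<open>The difference of the two sides is the relative entropy of the output law of
  \<open>P\<close> with respect to that of \<open>Q\<close>, since the terms in input and noise
  alone cancel.\<close>

lemma gibbs: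
  assumes "bounded_input Q S"
  shows "channel_information P \<le> (\<integral>x. input_divergence Q x \<partial>P)"
    and "channel_information P = (\<integral>x. input_divergence Q x \<partial>P) \<Longrightarrow>
      AE y in std_normal_plane. out_density Q y = out_density P y"
proof -
  interpret Q: bounded_input Q S by fact
  let ?\<gamma> = std_normal_plane
  let ?Y = "density ?\<gamma> (\<lambda>y. ennreal (out_density P y))"
  define D where "D y = ln (out_density P y) - ln (out_density Q y)" for y
  \<comment> \<open>Both densities have mass 1, so the extra terms leave the integral unchanged.
    They make the integrand nonnegative at every point, so that a zero integral forces it to vanish
    almost everywhere.\<close>
  define h where "h y = out_density P y * D y - out_density P y + out_density Q y" for y
  have [measurable]: "D \<in> borel_measurable borel"
    unfolding D_def[abs_def] by measurable
  have intD: "integrable (P \<Otimes>\<^sub>M ?\<gamma>) (\<lambda>w. D (case w of (x, z) \<Rightarrow> x + z))"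
    using integrable_ln_out_density_pair[OF assms] integrable_ln_out_density_pair[OF bounded_input_axioms]
    by (simp add: D_def split_beta')
  have "(\<integral>x. input_divergence Q x \<partial>P) - channel_information P =
      (\<integral>w. D (case w of (x, z) \<Rightarrow> x + z) \<partial>(P \<Otimes>\<^sub>M ?\<gamma>))"
    unfolding channel_information_eq_pair integral_input_divergence(1)[OF assms]
    by (subst Bochner_Integration.integral_diff[symmetric])
      (auto intro!: integrable_info_pair assms bounded_input_axioms Bochner_Integration.integral_cong
        simp: D_def)
  also have "\<dots> = (\<integral>y. D y \<partial>?Y)"
    unfolding distr_output[symmetric] by (rule integral_distr[symmetric]) measurable
  also have "\<dots> = (\<integral>y. out_density P y * D y \<partial>?\<gamma>)"
    by (subst integral_density) simp_all
  finally have diff: "(\<integral>x. input_divergence Q x \<partial>P) - channel_information P =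
      (\<integral>y. out_density P y * D y \<partial>?\<gamma>)" .
  have "integrable ?Y D"
    unfolding distr_output[symmetric] using intD by (subst integrable_distr_eq) simp_all
  then have GD: "integrable ?\<gamma> (\<lambda>y. out_density P y * D y)"
    by (subst (asm) integrable_density) simp_all
  then have h: "integrable ?\<gamma> h"
    unfolding h_def[abs_def] using integrable_out_density Q.integrable_out_density by simp
  have "(\<integral>y. h y \<partial>?\<gamma>) = (\<integral>y. out_density P y * D y \<partial>?\<gamma>)"
    unfolding h_def[abs_def] using GD integrable_out_density Q.integrable_out_density
    by (simp add: integral_out_density Q.integral_out_density)
  with diff have diff: "(\<integral>x. input_divergence Q x \<partial>P) - channel_information P = (\<integral>y. h y \<partial>?\<gamma>)"
    by simp
  \<comment> \<open>With \<open>u\<close> the ratio of the densities this is a positive multiple of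
    \<open>u - 1 - ln u\<close>, which is nonnegative and vanishes only at
    \<open>u = 1\<close>.\<close>
  have h_eq: "h y = out_density P y * ((out_density Q y / out_density P y - 1)
      - ln (out_density Q y / out_density P y))" for y
    by (simp add: h_def D_def ln_div right_diff_distrib)
  have "h y \<ge> 0" for y
    unfolding h_eq by (intro mult_nonneg_nonneg) (simp_all add: ln_le_minus_one)
  note h_nonneg = this
  show "channel_information P \<le> (\<integral>x. input_divergence Q x \<partial>P)"
  proof -
    have "0 \<le> (\<integral>y. h y \<partial>?\<gamma>)"
      using h_nonneg by (rule Bochner_Integration.integral_nonneg)
    with diff show ?thesis
      by linarith
  qed
  assume "channel_information P = (\<integral>x. input_divergence Q x \<partial>P)"
  with diff have "(\<integral>y. h y \<partial>?\<gamma>) = 0"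
    by linarith
  then have "AE y in ?\<gamma>. h y = 0"
    using integral_nonneg_eq_0_iff_AE[OF h] h_nonneg by simp
  then show "AE y in ?\<gamma>. out_density Q y = out_density P y"
  proof eventually_elim
    case (elim y)
    then have "ln (out_density Q y / out_density P y) = out_density Q y / out_density P y - 1"
      unfolding h_eq by simp
    then have "out_density Q y / out_density P y = 1"
      by (intro ln_eq_minus_one) simp_all
    then show ?case
      by simp
  qed
qed

end

subsection \<open>Strict concavity and uniqueness\<close>

text \<open>The weight \<open>l\<close> belongs to the second measure. A bind over a Bernoulli
  variable is used so that measurability, null sets and integrals come from the Giry monad.\<close>

definition mixture :: "real \<Rightarrow> 'a measure \<Rightarrow> 'a measure \<Rightarrow> 'a measure" where
  "mixture l P Q = measure_pmf (bernoulli_pmf l) \<bind> (\<lambda>b. if b then Q else P)"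

locale input_pair = P: bounded_input P R + Q: bounded_input Q R
  for P Q R +
  fixes l :: real
  assumes weight: "0 \<le> l" "l \<le> 1"
begin

lemma kernel_subprob:
  "(\<lambda>b. if b then Q else P) \<in> measure_pmf (bernoulli_pmf l) \<rightarrow>\<^sub>M subprob_algebra borel"
  by (auto simp: space_subprob_algebra P.prob_space_axioms Q.prob_space_axioms
      split: if_splits intro: prob_space_imp_subprob_space)

lemma kernel_prob:
  "(\<lambda>b. if b then Q else P) \<in> measure_pmf (bernoulli_pmf l) \<rightarrow>\<^sub>M prob_algebra borel"
  using kernel_subprob
  by (intro measurable_prob_algebraI) (auto simp: P.prob_space_axioms Q.prob_space_axioms)

lemma sets_mixture [simp, measurable_cong]: "sets (mixture l P Q) = sets borel"
  unfolding mixture_def by (rule sets_bind) auto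

lemma nn_integral_mixture:
  assumes "f \<in> borel_measurable borel"
  shows "(\<integral>\<^sup>+x. f x \<partial>mixture l P Q) =
    ennreal l * (\<integral>\<^sup>+x. f x \<partial>Q) + ennreal (1 - l) * (\<integral>\<^sup>+x. f x \<partial>P)"
  unfolding mixture_def nn_integral_bind[OF assms kernel_subprob]
  using weight by (simp add: mult.commute)

lemma AE_mixture:
  assumes [measurable]: "Measurable.pred borel p" and "AE x in P. p x" "AE x in Q. p x"
  shows "AE x in mixture l P Q. p x"
  unfolding mixture_def AE_bind[OF kernel_subprob assms(1)] using assms(2,3) by simp

lemma prob_space_mixture: "prob_space (mixture l P Q)"
  unfolding mixture_def
  by (rule prob_space_bind'[OF _ kernel_prob])
    (simp add: space_prob_algebra prob_space_measure_pmf)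

sublocale mix: bounded_input "mixture l P Q" R
proof (intro bounded_input.intro bounded_input_axioms.intro prob_space_mixture sets_mixture)
  show "AE x in mixture l P Q. norm x \<le> R"
    using P.bounded Q.bounded by (intro AE_mixture) auto
qed

lemma
  fixes f :: "real \<times> real \<Rightarrow> real"
  assumes "integrable P f" "integrable Q f"
  shows integrable_mixture: "integrable (mixture l P Q) f"
    and integral_mixture: "(\<integral>x. f x \<partial>mixture l P Q) = l * (\<integral>x. f x \<partial>Q) + (1 - l) * (\<integral>x. f x \<partial>P)"
proof -
  have [measurable]: "f \<in> borel_measurable borel"
    using borel_measurable_integrable[OF assms(1)] by simp
  show i: "integrable (mixture l P Q) f"
    using assms unfolding integrable_iff_bounded
    by (auto simp: nn_integral_mixture ennreal_mult_less_top)
  have fin: "(\<integral>\<^sup>+x. ennreal (f x) \<partial>K) < top" "(\<integral>\<^sup>+x. ennreal (- f x) \<partial>K) < top"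
    if "integrable K f" for K
  proof -
    have "(\<integral>\<^sup>+x. ennreal (norm (f x)) \<partial>K) < top"
      using that by (simp add: integrable_iff_bounded)
    moreover have "(\<integral>\<^sup>+x. ennreal (f x) \<partial>K) \<le> (\<integral>\<^sup>+x. ennreal (norm (f x)) \<partial>K)"
      "(\<integral>\<^sup>+x. ennreal (- f x) \<partial>K) \<le> (\<integral>\<^sup>+x. ennreal (norm (f x)) \<partial>K)"
      by (intro nn_integral_mono ennreal_leI; simp)+
    ultimately show "(\<integral>\<^sup>+x. ennreal (f x) \<partial>K) < top" "(\<integral>\<^sup>+x. ennreal (- f x) \<partial>K) < top"
      by (auto intro: le_less_trans)
  qed
  \<comment> \<open>\<open>enn2real\<close> is additive only on finite values, hence the finiteness
    of both signed parts above.\<close>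
  have e: "enn2real (ennreal l * a + ennreal (1 - l) * b) = l * enn2real a + (1 - l) * enn2real b"
    if "a < top" "b < top" for a b
    using weight that by (simp add: enn2real_plus enn2real_mult ennreal_mult_less_top)
  show "(\<integral>x. f x \<partial>mixture l P Q) = l * (\<integral>x. f x \<partial>Q) + (1 - l) * (\<integral>x. f x \<partial>P)"
    unfolding real_lebesgue_integral_def[OF i] real_lebesgue_integral_def[OF assms(1)]
      real_lebesgue_integral_def[OF assms(2)]
    by (simp add: nn_integral_mixture e fin assms algebra_simps)
qed

lemma out_density_mixture:
  "out_density (mixture l P Q) y = l * out_density Q y + (1 - l) * out_density P y"
  unfolding out_density_def by (intro integral_mixture P.integrable_tilt Q.integrable_tilt)

text \<open>The divergence in both terms is that of the mixture itself, so \<open>gibbs\<close>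
  applies to each component with the mixture as reference law.\<close>

lemma channel_information_mixture:
  "channel_information (mixture l P Q) =
    l * (\<integral>x. input_divergence (mixture l P Q) x \<partial>Q) +
    (1 - l) * (\<integral>x. input_divergence (mixture l P Q) x \<partial>P)"
  unfolding mix.channel_information_eq
  by (intro integral_mixture P.integral_input_divergence(2) Q.integral_input_divergence(2))
    (rule mix.bounded_input_axioms)+

end

section \<open>Recovering the input law from the output law\<close>

lemma (in bounded_input) laplace_output:
  "(\<integral>\<^sup>+y. ennreal (out_density P y) * ennreal (exp (t \<bullet> y)) \<partial>std_normal_plane) =
    ennreal ((\<integral>x. exp (t \<bullet> x) \<partial>P) * exp (t \<bullet> t / 2))"
proof -
  have i: "integrable P (\<lambda>x. exp (t \<bullet> x))"
    using bounded
    by (intro integrable_continuous_bounded_support[where R = R] prob_space_axioms sets_P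
        continuous_intros)
  \<comment> \<open>The Gaussian transform is read off from the fact that \<open>tilt t\<close>
    integrates to 1.\<close>
  have g: "(\<integral>\<^sup>+z. ennreal (exp (t \<bullet> z)) \<partial>std_normal_plane) = ennreal (exp (t \<bullet> t / 2))"
  proof -
    have "(\<integral>\<^sup>+z. ennreal (exp (t \<bullet> z)) \<partial>std_normal_plane) =
        (\<integral>\<^sup>+z. ennreal (tilt t z) * ennreal (exp (t \<bullet> t / 2)) \<partial>std_normal_plane)"
      by (simp add: tilt_def flip: ennreal_mult exp_add)
    then show ?thesis
      by (simp add: nn_integral_multc nn_integral_tilt)
  qed
  have "(\<integral>\<^sup>+y. ennreal (out_density P y) * ennreal (exp (t \<bullet> y)) \<partial>std_normal_plane) =
      (\<integral>\<^sup>+w. ennreal (exp (t \<bullet> (fst w + snd w))) \<partial>(P \<Otimes>\<^sub>M std_normal_plane))"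
    using nn_integral_output[of "\<lambda>y. ennreal (exp (t \<bullet> y))"] by (simp add: split_beta')
  also have "\<dots> = (\<integral>\<^sup>+x. \<integral>\<^sup>+z. ennreal (exp (t \<bullet> x)) * ennreal (exp (t \<bullet> z)) \<partial>std_normal_plane \<partial>P)"
    by (subst \<gamma>.nn_integral_fst[symmetric])
      (simp_all add: inner_add_right exp_add ennreal_mult)
  also have "\<dots> = (\<integral>\<^sup>+x. ennreal (exp (t \<bullet> x)) \<partial>P) * ennreal (exp (t \<bullet> t / 2))"
    by (simp add: nn_integral_cmult nn_integral_multc g)
  also have "(\<integral>\<^sup>+x. ennreal (exp (t \<bullet> x)) \<partial>P) = ennreal (\<integral>x. exp (t \<bullet> x) \<partial>P)"
    using i by (intro nn_integral_eq_integral) auto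
  finally show ?thesis
    by (simp add: ennreal_mult)
qed

text \<open>Independence makes the transform of the output the transform of the input times a
  positive Gaussian factor, which cancels.\<close>

lemma out_density_inject:
  assumes P: "bounded_input P R" and Q: "bounded_input Q R"
    and eq: "AE y in std_normal_plane. out_density P y = out_density Q y"
  shows "P = Q"
proof -
  interpret P: bounded_input P R by fact
  interpret Q: bounded_input Q R by fact
  show ?thesis
  proof (rule measure_eqI_laplace)
    fix t
    have "(\<integral>\<^sup>+y. ennreal (out_density P y) * ennreal (exp (t \<bullet> y)) \<partial>std_normal_plane) =
        (\<integral>\<^sup>+y. ennreal (out_density Q y) * ennreal (exp (t \<bullet> y)) \<partial>std_normal_plane)"
      using eq by (intro nn_integral_cong_AE) auto
    then show "(\<integral>x. exp (t \<bullet> x) \<partial>P) = (\<integral>x. exp (t \<bullet> x) \<partial>Q)"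
      unfolding P.laplace_output Q.laplace_output
      by (subst (asm) ennreal_inj) auto
  qed (auto intro: P.prob_space_axioms Q.prob_space_axioms P.bounded Q.bounded)
qed

section \<open>Inputs constrained to the ellipse\<close>

lemma norm_le_of_mem_ellipse:
  assumes "0 \<le> r\<^sub>m" "r\<^sub>m \<le> r\<^sub>p" "x \<in> ellipse r\<^sub>p r\<^sub>m"
  shows "norm x \<le> r\<^sub>p"
proof -
  obtain a b where x: "x = (a, b)" by (cases x)
  have e: "a\<^sup>2 / r\<^sub>p\<^sup>2 + b\<^sup>2 / r\<^sub>m\<^sup>2 \<le> 1" "r\<^sub>p = 0 \<Longrightarrow> a = 0" "r\<^sub>m = 0 \<Longrightarrow> b = 0"
    using assms(3) by (auto simp: ellipse_def x)
  have "a\<^sup>2 + b\<^sup>2 \<le> r\<^sub>p\<^sup>2"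
  proof (cases "r\<^sub>p = 0")
    case True
    then show ?thesis
      using e assms by simp
  next
    case False
    \<comment> \<open>Enlarging the radius decreases the quotient. For \<open>r\<^sub>m = 0\<close>
      the right side is 0 by convention, and there the explicit constraint \<open>b = 0\<close>
      enters.\<close>
    have "b\<^sup>2 / r\<^sub>p\<^sup>2 \<le> b\<^sup>2 / r\<^sub>m\<^sup>2"
    proof (cases "r\<^sub>m = 0")
      case False
      then show ?thesis
        using assms by (intro divide_left_mono power_mono) auto
    qed (simp add: e)
    then have "a\<^sup>2 / r\<^sub>p\<^sup>2 + b\<^sup>2 / r\<^sub>p\<^sup>2 \<le> 1"
      using e(1) by linarith
    then show ?thesis
      using False by (simp add: field_simps)
  qed
  then show ?thesis
    using assms real_sqrt_le_mono by (fastforce simp: x norm_Pair)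
qed

lemma sets_ellipse [measurable]: "ellipse r\<^sub>p r\<^sub>m \<in> sets borel"
proof -
  have "{x. (fst x)\<^sup>2 / r\<^sub>p\<^sup>2 + (snd x)\<^sup>2 / r\<^sub>m\<^sup>2 \<le> 1 \<and> (r\<^sub>p = 0 \<longrightarrow> fst x = 0) \<and> (r\<^sub>m = 0 \<longrightarrow> snd x = 0)}
      \<in> sets (borel :: (real \<times> real) measure)"
    by measurable
  then show ?thesis
    by (simp add: ellipse_def split_beta')
qed

lemma bounded_input_admissible:
  assumes "0 \<le> r\<^sub>m" "r\<^sub>m \<le> r\<^sub>p" "admissible_input r\<^sub>p r\<^sub>m P"
  shows "bounded_input P r\<^sub>p"
proof -
  from assms(3) have "AE x in P. norm x \<le> r\<^sub>p"
    unfolding admissible_input_def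
    by (auto intro: eventually_mono norm_le_of_mem_ellipse[OF assms(1,2)])
  with assms(3) show ?thesis
    by (simp add: admissible_input_def bounded_input_def bounded_input_axioms_def)
qed

lemma admissible_mixture:
  assumes "0 \<le> r\<^sub>m" "r\<^sub>m \<le> r\<^sub>p" "admissible_input r\<^sub>p r\<^sub>m P" "admissible_input r\<^sub>p r\<^sub>m Q" "0 \<le> l" "l \<le> 1"
  shows "admissible_input r\<^sub>p r\<^sub>m (mixture l P Q)"
proof -
  interpret input_pair P Q r\<^sub>p l
    using assms by (simp add: input_pair_def input_pair_axioms_def bounded_input_admissible)
  show ?thesis
    using assms(3,4) prob_space_mixture
    by (auto simp: admissible_input_def intro!: AE_mixture)
qed

lemma capacity_achieving_unique:
  assumes r: "0 \<le> r\<^sub>m" "r\<^sub>m \<le> r\<^sub>p" and P: "capacity_achieving r\<^sub>p r\<^sub>m P" and Q: "capacity_achieving r\<^sub>p r\<^sub>m Q"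
  shows "P = Q"
proof -
  have aP: "admissible_input r\<^sub>p r\<^sub>m P" and aQ: "admissible_input r\<^sub>p r\<^sub>m Q"
    using P Q by (auto simp: capacity_achieving_def is_arg_max_def)
  have max: "channel_information K \<le> channel_information P" "channel_information K \<le> channel_information Q"
    if "admissible_input r\<^sub>p r\<^sub>m K" for K
    using P Q that by (auto simp: capacity_achieving_def is_arg_max_linorder)
  interpret input_pair P Q r\<^sub>p "1 / 2"
    using r aP aQ by (simp add: input_pair_def input_pair_axioms_def bounded_input_admissible)
  define p where "p = (\<integral>x. input_divergence (mixture (1 / 2) P Q) x \<partial>P)"
  define q where "q = (\<integral>x. input_divergence (mixture (1 / 2) P Q) x \<partial>Q)"
  have "channel_information (mixture (1 / 2) P Q) \<le> channel_information P"
    by (intro max admissible_mixture aP aQ r) auto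
  then have "1 / 2 * q + (1 - 1 / 2) * p \<le> channel_information P"
    unfolding channel_information_mixture p_def q_def .
  moreover have "channel_information P \<le> p" "channel_information Q \<le> q"
    unfolding p_def q_def
    by (rule P.gibbs(1)[OF mix.bounded_input_axioms] Q.gibbs(1)[OF mix.bounded_input_axioms])+
  moreover have "channel_information Q = channel_information P"
    using max(1)[OF aQ] max(2)[OF aP] by (rule antisym)
  \<comment> \<open>With C the common maximum, C \<le> p and C \<le> q while (p + q) / 2 \<le> C.
    Hence p = q = C, and the equality case of \<open>gibbs\<close> identifies both output densities
    with that of the midpoint.\<close>
  ultimately have eqP: "channel_information P = p" and eqQ: "channel_information Q = q"
    by auto
  show ?thesis
  proof (rule out_density_inject)
    show "AE y in std_normal_plane. out_density P y = out_density Q y"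
      using P.gibbs(2)[OF mix.bounded_input_axioms eqP[unfolded p_def]]
        Q.gibbs(2)[OF mix.bounded_input_axioms eqQ[unfolded q_def]]
      by eventually_elim simp
  qed (fact P.bounded_input_axioms Q.bounded_input_axioms)+
qed

subsection \<open>Symmetry and optimality conditions\<close>

lemma reflect_reflect:
  assumes "\<bar>a\<bar> = 1" "\<bar>b\<bar> = 1"
  shows "reflect a b (reflect a b z) = z"
proof -
  have "a * a = 1" "b * b = 1"
    using assms by (auto simp: abs_if split: if_splits)
  then show ?thesis
    by (simp add: reflect_def mult.assoc[symmetric])
qed

text \<open>Diagonal maps are self-adjoint. Together with \<open>reflect_reflect\<close> this makes
  a sign change orthogonal and moves it between the arguments of \<open>tilt\<close>.\<close>

lemma inner_reflect: "reflect a b x \<bullet> y = x \<bullet> reflect a b y"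
  by (simp add: reflect_def inner_prod_def)

lemma capacity_achieving_reflect:
  assumes r: "0 \<le> r\<^sub>m" "r\<^sub>m \<le> r\<^sub>p" and P: "capacity_achieving r\<^sub>p r\<^sub>m P"
    and ab: "\<bar>a\<bar> = 1" "\<bar>b\<bar> = 1"
  shows "distr P borel (reflect a b) = P"
proof -
  let ?\<sigma> = "reflect a b"
  let ?Q = "distr P borel ?\<sigma>"
  have aP: "admissible_input r\<^sub>p r\<^sub>m P"
    and max: "\<And>K. admissible_input r\<^sub>p r\<^sub>m K \<Longrightarrow> channel_information K \<le> channel_information P"
    using P by (auto simp: capacity_achieving_def is_arg_max_linorder)
  interpret P: bounded_input P r\<^sub>p
    using bounded_input_admissible[OF r aP] .
  have sq: "a\<^sup>2 = 1" "b\<^sup>2 = 1"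
    using ab by (metis power2_abs one_power2)+
  have ell: "?\<sigma> x \<in> ellipse r\<^sub>p r\<^sub>m" if "x \<in> ellipse r\<^sub>p r\<^sub>m" for x
    using that by (auto simp: ellipse_def reflect_def power_mult_distrib sq)
  have aQ: "admissible_input r\<^sub>p r\<^sub>m ?Q"
    unfolding admissible_input_def
  proof (intro conjI)
    show "prob_space ?Q"
      by (rule P.prob_space_distr) simp
    have "AE x in P. ?\<sigma> x \<in> ellipse r\<^sub>p r\<^sub>m"
      using aP ell by (auto simp: admissible_input_def elim!: eventually_mono)
    then show "AE x in ?Q. x \<in> ellipse r\<^sub>p r\<^sub>m"
      by (subst AE_distr_iff) auto
  qed simp
  interpret Q: bounded_input ?Q r\<^sub>p
    using bounded_input_admissible[OF r aQ] .
  have G: "out_density ?Q y = out_density P (?\<sigma> y)" for y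
    unfolding out_density_def
    by (subst integral_distr) (simp_all add: tilt_def inner_reflect reflect_reflect ab)
  \<comment> \<open>The noise is invariant, so the noise variable may be reflected together with the
    input.\<close>
  have div: "input_divergence ?Q x = input_divergence P (?\<sigma> x)" for x
  proof -
    have "(\<integral>z. ln (out_density P (?\<sigma> x + z)) \<partial>std_normal_plane) =
        (\<integral>z. ln (out_density P (?\<sigma> x + z)) \<partial>distr std_normal_plane borel ?\<sigma>)"
      by (simp add: distr_std_normal_plane_reflect ab)
    also have "\<dots> = (\<integral>z. ln (out_density P (?\<sigma> x + ?\<sigma> z)) \<partial>std_normal_plane)"
      by (rule integral_distr) measurable
    finally show ?thesis
      by (simp add: input_divergence_def G reflect_add inner_reflect reflect_reflect ab)
  qed
  have [measurable]: "input_divergence P \<in> borel_measurable borel"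
    using borel_measurable_integrable[OF P.integral_input_divergence(2)[OF P.bounded_input_axioms]]
    by simp
  have "channel_information ?Q = (\<integral>x. input_divergence P (?\<sigma> x) \<partial>?Q)"
    by (simp add: Q.channel_information_eq div)
  also have "\<dots> = (\<integral>x. input_divergence P (?\<sigma> (?\<sigma> x)) \<partial>P)"
    by (rule integral_distr) measurable
  also have "\<dots> = channel_information P"
    by (simp add: P.channel_information_eq reflect_reflect ab)
  finally have "capacity_achieving r\<^sub>p r\<^sub>m ?Q"
    using aQ max by (simp add: capacity_achieving_def is_arg_max_linorder)
  with r P show ?thesis
    using capacity_achieving_unique by blast
qed

text \<open>Let M mix in a point mass at \<open>x\<close> with weight l. By \<open>gibbs\<close>,
  I(M) is at least l * D_M(x) + (1 - l) * I(P), and by maximality at most I(P). Hence D_M(x) \<le>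
  I(P) for each l > 0, and l tends to 0.\<close>

lemma input_divergence_le_capacity:
  assumes r: "0 \<le> r\<^sub>m" "r\<^sub>m \<le> r\<^sub>p" and P: "capacity_achieving r\<^sub>p r\<^sub>m P"
    and x: "x \<in> ellipse r\<^sub>p r\<^sub>m"
  shows "input_divergence P x \<le> channel_information P"
proof -
  let ?Q = "return borel x"
  let ?l = "\<lambda>n. inverse (real (Suc n))"
  let ?M = "\<lambda>n. mixture (?l n) P ?Q"
  have aP: "admissible_input r\<^sub>p r\<^sub>m P"
    and max: "\<And>K. admissible_input r\<^sub>p r\<^sub>m K \<Longrightarrow> channel_information K \<le> channel_information P"
    using P by (auto simp: capacity_achieving_def is_arg_max_linorder)
  have aQ: "admissible_input r\<^sub>p r\<^sub>m ?Q"
    using x by (auto simp: admissible_input_def prob_space_return AE_return)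
  have l: "0 < ?l n" "?l n \<le> 1" for n
    by (simp_all add: field_simps)
  have pair: "input_pair P ?Q r\<^sub>p (?l n)" for n
    using r aP aQ l[of n] by (simp add: input_pair_def input_pair_axioms_def bounded_input_admissible)
  interpret P: bounded_input P r\<^sub>p
    using bounded_input_admissible[OF r aP] .
  have bound: "input_divergence (?M n) x \<le> channel_information P" for n
  proof -
    interpret input_pair P ?Q r\<^sub>p "?l n" by (rule pair)
    have "input_divergence (?M n) \<in> borel_measurable borel"
      using borel_measurable_integrable[OF P.integral_input_divergence(2)[OF mix.bounded_input_axioms]]
      by simp
    then have "?l n * input_divergence (?M n) x + (1 - ?l n) * channel_information P
        \<le> channel_information (?M n)"
      unfolding channel_information_mixture
      using l[of n] P.gibbs(1)[OF mix.bounded_input_axioms]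
      by (simp add: integral_return mult_left_mono)
    also have "\<dots> \<le> channel_information P"
      using admissible_mixture[OF r aP aQ less_imp_le[OF l(1)] l(2)] by (rule max)
    finally have "?l n * input_divergence (?M n) x \<le> ?l n * channel_information P"
      by (simp add: algebra_simps)
    then show ?thesis
      using l(1)[of n] by (simp only: mult_le_cancel_left_pos)
  qed
  have meas [measurable]: "out_density (?M n) \<in> borel_measurable borel" for n
  proof -
    interpret input_pair P ?Q r\<^sub>p "?l n" by (rule pair)
    show ?thesis by measurable
  qed
  \<comment> \<open>All mixtures live in the same ball, so one linear function of
    \<open>norm z\<close> dominates every log-density.\<close>
  have "(\<lambda>n. \<integral>z. ln (out_density (?M n) (x + z)) \<partial>std_normal_plane) \<longlonglongrightarrow>
      (\<integral>z. ln (out_density P (x + z)) \<partial>std_normal_plane)"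
  proof (rule integral_dominated_convergence)
    show "integrable std_normal_plane (\<lambda>z. r\<^sub>p * norm x + r\<^sub>p * norm z + r\<^sub>p\<^sup>2 / 2)"
      using integrable_norm_std_normal_plane by simp
    show "AE z in std_normal_plane. (\<lambda>n. ln (out_density (?M n) (x + z)))
        \<longlonglongrightarrow> ln (out_density P (x + z))"
    proof (rule AE_I2)
      fix z
      have "(\<lambda>n. ?l n * out_density ?Q (x + z) + (1 - ?l n) * out_density P (x + z))
          \<longlonglongrightarrow> 0 * out_density ?Q (x + z) + (1 - 0) * out_density P (x + z)"
        by (intro tendsto_intros LIMSEQ_inverse_real_of_nat)
      then show "(\<lambda>n. ln (out_density (?M n) (x + z))) \<longlonglongrightarrow> ln (out_density P (x + z))"
        by (intro tendsto_ln) (simp_all only: input_pair.out_density_mixture[OF pair] P.out_density_pos mult_zero_left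
          add_0 diff_zero mult_1 simp_thms not_False_eq_True)
    qed
    show "AE z in std_normal_plane. norm (ln (out_density (?M n) (x + z)))
        \<le> r\<^sub>p * norm x + r\<^sub>p * norm z + r\<^sub>p\<^sup>2 / 2" for n
    proof (rule AE_I2)
      fix z
      interpret input_pair P ?Q r\<^sub>p "?l n" by (rule pair)
      have "r\<^sub>p * norm (x + z) \<le> r\<^sub>p * (norm x + norm z)"
        using r norm_triangle_ineq by (intro mult_left_mono) auto
      then show "norm (ln (out_density (?M n) (x + z))) \<le> r\<^sub>p * norm x + r\<^sub>p * norm z + r\<^sub>p\<^sup>2 / 2"
        using mix.abs_ln_out_density_le[of "x + z"] by (simp add: distrib_left)
    qed
  qed measurable
  then have "(\<lambda>n. input_divergence (?M n) x) \<longlonglongrightarrow> input_divergence P x"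
    unfolding input_divergence_def by (intro tendsto_intros)
  then show ?thesis
    using bound by (intro LIMSEQ_le_const2) auto
qed

text \<open>The \<open>P\<close>-average of the divergence is the information of \<open>P\<close>,
  which is also an upper bound on the ellipse.\<close>

lemma AE_input_divergence_eq_capacity:
  assumes r: "0 \<le> r\<^sub>m" "r\<^sub>m \<le> r\<^sub>p" and P: "capacity_achieving r\<^sub>p r\<^sub>m P"
  shows "AE x in P. input_divergence P x = channel_information P"
proof -
  have aP: "admissible_input r\<^sub>p r\<^sub>m P"
    using P by (auto simp: capacity_achieving_def is_arg_max_linorder)
  interpret P: bounded_input P r\<^sub>p
    using bounded_input_admissible[OF r aP] .
  let ?g = "\<lambda>x. channel_information P - input_divergence P x"
  note i = P.integral_input_divergence(2)[OF P.bounded_input_axioms]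
  have "AE x in P. 0 \<le> ?g x"
    using aP input_divergence_le_capacity[OF r P]
    by (auto simp: admissible_input_def elim!: eventually_mono)
  moreover have "(\<integral>x. ?g x \<partial>P) = 0"
    using i by (simp add: P.prob_space[simplified] flip: P.channel_information_eq)
  moreover have "integrable P ?g"
    using i by simp
  ultimately have "AE x in P. ?g x = 0"
    by (simp add: integral_nonneg_eq_0_iff_AE)
  then show ?thesis
    by eventually_elim simp
qed

subsection \<open>Strict subharmonicity of the divergence\<close>

text \<open>Fourth-order Taylor expansion at \<open>s\<close> and \<open>- s\<close>: odd terms
  cancel, the quadratic terms add up to \<open>s^2\<close>, and each remainder is at most
  \<open>s^4 / 2\<close>.\<close>

lemma exp_add_exp_minus_le:
  fixes s :: real
  assumes "\<bar>s\<bar> \<le> 1"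
  shows "exp s + exp (- s) - 2 \<le> s\<^sup>2 + s ^ 4"
proof -
  have "exp u \<le> 1 + u + u\<^sup>2 / 2 + u ^ 3 / 6 + u ^ 4 / 2" if "\<bar>u\<bar> \<le> 1" for u :: real
  proof -
    obtain t where t: "\<bar>t\<bar> \<le> \<bar>u\<bar>" "exp u = (\<Sum>m<4. u ^ m / fact m) + exp t / fact 4 * u ^ 4"
      using Maclaurin_exp_le[of u 4] by blast
    have "exp t \<le> exp 1"
      using t(1) that by simp
    also have "\<dots> \<le> 3"
      by (rule exp_le)
    \<comment> \<open>The coefficient is at most 3 / 24, so 1 / 2 is generous.\<close>
    finally have "exp t / fact 4 * u ^ 4 \<le> 1 / 2 * u ^ 4"
      by (intro mult_right_mono) (auto simp: fact_numeral)
    moreover have "(\<Sum>m<4. u ^ m / fact m) = 1 + u + u\<^sup>2 / 2 + u ^ 3 / 6"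
      by (simp add: numeral_eq_Suc)
    ultimately show ?thesis
      using t(2) by simp
  qed
  from this[of s] this[of "- s"] assms show ?thesis
    by simp
qed

context bounded_input
begin

text \<open>The quadratic part contributes exactly \<open>v \<bullet> v\<close>. Two axis steps of
  length \<open>t\<close> thus give \<open>2 * t^2\<close>, the term that the logarithms have to
  beat.\<close>

lemma input_divergence_second_difference:
  "input_divergence P (x + v) + input_divergence P (x - v) - 2 * input_divergence P x =
    v \<bullet> v - (\<integral>z. ln (out_density P (x + z + v)) + ln (out_density P (x + z - v))
      - 2 * ln (out_density P (x + z)) \<partial>std_normal_plane)"
proof -
  have i: "integrable std_normal_plane (\<lambda>z. ln (out_density P (x + z + v)))"
    "integrable std_normal_plane (\<lambda>z. ln (out_density P (x + z - v)))"
    using integrable_ln_out_density[of "x + v"] integrable_ln_out_density[of "x - v"]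
    by (simp_all add: algebra_simps)
  have "(\<integral>z. ln (out_density P (x + z + v)) + ln (out_density P (x + z - v))
      - 2 * ln (out_density P (x + z)) \<partial>std_normal_plane) =
      (\<integral>z. ln (out_density P (x + v + z)) \<partial>std_normal_plane) +
      (\<integral>z. ln (out_density P (x - v + z)) \<partial>std_normal_plane) -
      2 * (\<integral>z. ln (out_density P (x + z)) \<partial>std_normal_plane)"
    using i integrable_ln_out_density[of x] by (simp add: algebra_simps)
  then show ?thesis
    by (simp add: input_divergence_def inner_add_left inner_add_right inner_diff_left
        inner_diff_right inner_commute[of v x] field_simps)
qed

lemma integrable_tilt_mult:
  assumes "f \<in> borel_measurable borel" "\<And>x. norm x \<le> R \<Longrightarrow> \<bar>f x\<bar> \<le> B"
  shows "integrable P (\<lambda>x. tilt x y * f x)"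
proof (rule integrable_const_bound)
  show "AE x in P. norm (tilt x y * f x) \<le> exp (R * norm y) * B"
    using bounded
  proof eventually_elim
    case (elim x)
    then show ?case
      using assms(2)[of x] tilt_le[of x R y] by (simp add: abs_mult mult_mono)
  qed
qed (use assms(1) in measurable)

text \<open>The bound \<open>ln u \<le> u - 1\<close> discards the squared conditional mean of \<open>X\<close>, which is not needed, and
  turns the second difference of a logarithm into a linear functional of \<open>P\<close>.\<close>

lemma ln_out_density_second_difference:
  "ln (out_density P (y + v)) + ln (out_density P (y - v)) - 2 * ln (out_density P y) \<le>
    (\<integral>x. tilt x y * (exp (x \<bullet> v) + exp (- (x \<bullet> v)) - 2) \<partial>P) / out_density P y"
proof -
  have ln: "ln (out_density P w) - ln (out_density P y) \<le> out_density P w / out_density P y - 1" for w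
    using ln_le_minus_one[of "out_density P w / out_density P y"] by (simp add: ln_div)
  have t: "tilt x (y + v) = tilt x y * exp (x \<bullet> v)" "tilt x (y - v) = tilt x y * exp (- (x \<bullet> v))" for x
    by (simp_all add: tilt_def inner_add_right inner_diff_right algebra_simps flip: exp_add)
  have "(\<integral>x. tilt x y * (exp (x \<bullet> v) + exp (- (x \<bullet> v)) - 2) \<partial>P) =
      (\<integral>x. tilt x (y + v) + tilt x (y - v) - 2 * tilt x y \<partial>P)"
    by (simp only: t distrib_left right_diff_distrib mult.commute[of _ 2])
  also have "\<dots> = out_density P (y + v) + out_density P (y - v) - 2 * out_density P y"
    unfolding out_density_def by (simp add: integrable_tilt)
  finally have "(\<integral>x. tilt x y * (exp (x \<bullet> v) + exp (- (x \<bullet> v)) - 2) \<partial>P) / out_density P y =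
      out_density P (y + v) / out_density P y + out_density P (y - v) / out_density P y - 2"
    by (simp add: add_divide_distrib diff_divide_distrib)
  then show ?thesis
    using ln[of "y + v"] ln[of "y - v"] by linarith
qed

text \<open>The four neighbours form the five-point discrete Laplacian. After division by
  \<open>t^2\<close> it is bounded below, up to an error \<open>4 * t^2\<close>, by a positive mean
  of 2 - |X|^2.\<close>

lemma input_divergence_strictly_subharmonic:
  assumes R: "R = sqrt 2" and nb: "\<not> (AE x in P. x \<bullet> x = 2)"
  shows "eventually (\<lambda>t. 4 * input_divergence P x <
    input_divergence P (x + (t, 0)) + input_divergence P (x - (t, 0)) +
    input_divergence P (x + (0, t)) + input_divergence P (x - (0, t))) (at_right 0)"
proof -
  \<comment> \<open>The conditional mean of 2 - |X|^2 given the output \<open>y\<close>: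
    \<open>tilt x y / out_density P y\<close> is the posterior density of the input with respect to
    \<open>P\<close>.\<close>
  define q where "q y = (\<integral>x. tilt x y * (2 - x \<bullet> x) \<partial>P) / out_density P y" for y
  have xx: "x \<bullet> x \<le> 2" if "norm x \<le> R" for x :: "real \<times> real"
    using that power_mono[of "norm x" "sqrt 2" 2] by (simp add: R dot_square_norm)
  have int: "integrable P (\<lambda>x. tilt x y * (2 - x \<bullet> x))" for y
    using xx by (intro integrable_tilt_mult[where B = 2]) auto
  have nonneg: "AE x in P. 0 \<le> tilt x y * (2 - x \<bullet> x)" for y
    using bounded by eventually_elim (simp add: xx)
  have q_pos: "0 < q y" for y
  proof -
    \<comment> \<open>As \<open>tilt\<close> never vanishes, a zero integral at a single
      \<open>y\<close> would already put \<open>P\<close> on the circle of radius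
      \<open>sqrt 2\<close>.\<close>
    have "(\<integral>x. tilt x y * (2 - x \<bullet> x) \<partial>P) \<noteq> 0"
    proof
      assume "(\<integral>x. tilt x y * (2 - x \<bullet> x) \<partial>P) = 0"
      then have "AE x in P. tilt x y * (2 - x \<bullet> x) = 0"
        using integral_nonneg_eq_0_iff_AE[OF int nonneg] by simp
      then have "AE x in P. x \<bullet> x = 2"
        by eventually_elim simp
      with nb show False
        by simp
    qed
    moreover have "0 \<le> (\<integral>x. tilt x y * (2 - x \<bullet> x) \<partial>P)"
      using nonneg by (rule integral_nonneg_AE)
    ultimately show ?thesis
      by (simp add: q_def)
  qed
  have q_le: "q y \<le> 2" for y
  proof -
    have "(\<integral>x. tilt x y * (2 - x \<bullet> x) \<partial>P) \<le> (\<integral>x. 2 * tilt x y \<partial>P)"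
      by (intro integral_mono int integrable_mult_right integrable_tilt)
        (simp add: mult.commute[of _ 2] right_diff_distrib)
    then show ?thesis
      by (simp add: q_def divide_le_eq) (simp add: out_density_def)
  qed
  have [measurable]: "q \<in> borel_measurable borel"
    unfolding q_def[abs_def] by measurable
  have qi: "integrable std_normal_plane (\<lambda>z. q (x + z))"
    using q_pos q_le by (intro \<gamma>.integrable_const_bound[where B = 2]) (auto simp: less_imp_le)
  define k where "k = (\<integral>z. q (x + z) \<partial>std_normal_plane)"
  have "k \<noteq> 0"
  proof
    assume "k = 0"
    then have "AE z in std_normal_plane. q (x + z) = 0"
      using integral_nonneg_eq_0_iff_AE[OF qi] q_pos by (simp add: k_def less_imp_le)
    then have "AE z in std_normal_plane. False"
      by eventually_elim (use q_pos in \<open>metis less_irrefl\<close>)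
    then show False
      by simp
  qed
  moreover have "0 \<le> k"
    unfolding k_def using q_pos by (intro Bochner_Integration.integral_nonneg) (simp add: less_imp_le)
  ultimately have "0 < k"
    by simp

  \<comment> \<open>For \<open>t < 1 / 2\<close> and coordinates of size at most 2, the exponents
    \<open>t * fst x\<close> and \<open>t * snd x\<close> stay in the range of
    \<open>exp_add_exp_minus_le\<close>.\<close>
  have main: "t\<^sup>2 * (k - 4 * t\<^sup>2) \<le>
    input_divergence P (x + (t, 0)) + input_divergence P (x - (t, 0)) +
    input_divergence P (x + (0, t)) + input_divergence P (x - (0, t)) - 4 * input_divergence P x"
    if t: "0 < t" "t < 1 / 2" for t :: real
  proof -
    define D where "D v y = ln (out_density P (y + v)) + ln (out_density P (y - v))
      - 2 * ln (out_density P y)" for v y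
    have D_int: "integrable std_normal_plane (\<lambda>z. D v (x + z))" for v
      using integrable_ln_out_density[of "x + v"] integrable_ln_out_density[of "x - v"]
        integrable_ln_out_density[of x]
      by (simp add: D_def algebra_simps)
    define e where "e s = exp s + exp (- s) - 2" for s :: real
    have e_meas [measurable]: "e \<in> borel_measurable borel"
      unfolding e_def[abs_def] by measurable
    have small: "\<bar>t * fst x\<bar> \<le> 1" "\<bar>t * snd x\<bar> \<le> 1" if "norm x \<le> R" for x :: "real \<times> real"
    proof -
      have "norm x \<le> 2"
        using that R sqrt2_less_2 by linarith
      then have "\<bar>fst x\<bar> \<le> 2" "\<bar>snd x\<bar> \<le> 2"
        using norm_fst_le[of "fst x" "snd x"] norm_snd_le[of "snd x" "fst x"] by simp_all
      then show "\<bar>t * fst x\<bar> \<le> 1" "\<bar>t * snd x\<bar> \<le> 1"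
        using t mult_mono[of t "1 / 2" "\<bar>fst x\<bar>" 2] mult_mono[of t "1 / 2" "\<bar>snd x\<bar>" 2]
        by (simp_all add: abs_mult)
    qed
    have e_nonneg: "0 \<le> e s" for s
      using exp_ge_add_one_self[of s] exp_ge_add_one_self[of "- s"] unfolding e_def by linarith
    have e_le: "e s \<le> s\<^sup>2 + s ^ 4" if "\<bar>s\<bar> \<le> 1" for s
      using exp_add_exp_minus_le[OF that] by (simp add: e_def)
    have e_bound: "\<bar>e s\<bar> \<le> 2" if "\<bar>s\<bar> \<le> 1" for s
      using e_le[OF that] e_nonneg[of s] that power_mono[of "\<bar>s\<bar>" 1 2] power_mono[of "\<bar>s\<bar>" 1 4]
      by simp
    \<comment> \<open>The 4 bounds the sum of the fourth powers of the coordinates, which is at most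
      the square of \<open>x \<bullet> x\<close>, hence at most \<open>2^2\<close>.\<close>
    have e_sum: "e (t * fst x) + e (t * snd x) \<le> t\<^sup>2 * (x \<bullet> x) + 4 * t ^ 4"
      if "norm x \<le> R" for x :: "real \<times> real"
    proof -
      have eq: "x \<bullet> x = (fst x)\<^sup>2 + (snd x)\<^sup>2"
        by (simp add: inner_prod_def power2_eq_square)
      have "fst x ^ 4 + snd x ^ 4 \<le> ((fst x)\<^sup>2 + (snd x)\<^sup>2)\<^sup>2"
        by (simp add: power2_sum flip: power_mult)
      also have "\<dots> \<le> 2\<^sup>2"
        using xx[OF that] eq by (intro power_mono) auto
      finally have "t ^ 4 * (fst x ^ 4 + snd x ^ 4) \<le> t ^ 4 * 4"
        by (intro mult_left_mono) auto
      then show ?thesis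
        using e_le[OF small(1)[OF that]] e_le[OF small(2)[OF that]]
        by (simp add: eq power_mult_distrib algebra_simps)
    qed
    \<comment> \<open>Writing \<open>x \<bullet> x\<close> as \<open>2 - (2 - x \<bullet> x)\<close>
      splits the second-order term into the constant \<open>2 * t^2\<close> and the gain
      \<open>t^2 * q y\<close>.\<close>
    have pointwise: "D (t, 0) y + D (0, t) y \<le> (2 * t\<^sup>2 + 4 * t ^ 4) - t\<^sup>2 * q y" for y
    proof -
      have i1: "integrable P (\<lambda>x. tilt x y * e (t * fst x))"
        using small e_bound by (intro integrable_tilt_mult[where B = 2]) auto
      have i2: "integrable P (\<lambda>x. tilt x y * e (t * snd x))"
        using small e_bound by (intro integrable_tilt_mult[where B = 2]) auto
      have i3: "integrable P (\<lambda>x. (2 * t\<^sup>2 + 4 * t ^ 4) * tilt x y - t\<^sup>2 * (tilt x y * (2 - x \<bullet> x)))"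
        using int integrable_tilt by simp
      have "D (t, 0) y + D (0, t) y \<le> (\<integral>x. tilt x y * e (t * fst x) \<partial>P) / out_density P y
          + (\<integral>x. tilt x y * e (t * snd x) \<partial>P) / out_density P y"
        using ln_out_density_second_difference[of y "(t, 0)"]
          ln_out_density_second_difference[of y "(0, t)"]
        by (simp add: D_def e_def inner_prod_def mult.commute[of t])
      also have "\<dots> = (\<integral>x. tilt x y * e (t * fst x) + tilt x y * e (t * snd x) \<partial>P) / out_density P y"
        using i1 i2 by (simp add: add_divide_distrib)
      also have "\<dots> \<le> (\<integral>x. (2 * t\<^sup>2 + 4 * t ^ 4) * tilt x y - t\<^sup>2 * (tilt x y * (2 - x \<bullet> x)) \<partial>P)
          / out_density P y"
      proof (intro divide_right_mono integral_mono_AE i3)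
        show "integrable P (\<lambda>x. tilt x y * e (t * fst x) + tilt x y * e (t * snd x))"
          using i1 i2 by simp
        show "AE x in P. tilt x y * e (t * fst x) + tilt x y * e (t * snd x)
            \<le> (2 * t\<^sup>2 + 4 * t ^ 4) * tilt x y - t\<^sup>2 * (tilt x y * (2 - x \<bullet> x))"
          using bounded
        proof eventually_elim
          case (elim x)
          have "tilt x y * (e (t * fst x) + e (t * snd x)) \<le> tilt x y * (t\<^sup>2 * (x \<bullet> x) + 4 * t ^ 4)"
            using e_sum[OF elim] by (rule mult_left_mono) simp
          then show ?case
            by (simp add: algebra_simps)
        qed
      qed simp
      also have "\<dots> = (2 * t\<^sup>2 + 4 * t ^ 4) - t\<^sup>2 * q y"
        using int integrable_tilt
        by (simp add: q_def diff_divide_distrib flip: out_density_def)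
      finally show ?thesis .
    qed
    have "(\<integral>z. D (t, 0) (x + z) \<partial>std_normal_plane) + (\<integral>z. D (0, t) (x + z) \<partial>std_normal_plane) =
        (\<integral>z. D (t, 0) (x + z) + D (0, t) (x + z) \<partial>std_normal_plane)"
      using D_int by simp
    also have "\<dots> \<le> (\<integral>z. (2 * t\<^sup>2 + 4 * t ^ 4) - t\<^sup>2 * q (x + z) \<partial>std_normal_plane)"
      using D_int qi pointwise by (intro integral_mono) auto
    also have "\<dots> = 2 * t\<^sup>2 + 4 * t ^ 4 - t\<^sup>2 * k"
      using qi by (simp add: k_def \<gamma>.prob_space[simplified])
    finally show ?thesis
      using input_divergence_second_difference[of x "(t, 0)"]
        input_divergence_second_difference[of x "(0, t)"]
      by (simp add: D_def power2_eq_square power4_eq_xxxx algebra_simps)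
  qed
  have "eventually (\<lambda>t::real. 0 < t \<and> t < 1 / 2 \<and> t < k / 4) (at_right 0)"
    using \<open>0 < k\<close> by (intro eventually_conj eventually_at_right_less order_tendstoD(2)[OF tendsto_ident_at]) auto
  then show ?thesis
  proof eventually_elim
    case (elim t)
    have "4 * t\<^sup>2 < k"
    proof -
      have "t\<^sup>2 \<le> t"
        using elim by (simp add: power2_eq_square mult_left_le)
      with elim show ?thesis
        by simp
    qed
    with elim have "0 < t\<^sup>2 * (k - 4 * t\<^sup>2)"
      by simp
    with main[of t] elim show ?case
      by linarith
  qed
qed

end

subsection \<open>The optimal input law\<close>

lemma capacity_achieving_boundary:
  assumes r: "0 < r\<^sub>m" "r\<^sub>m \<le> r\<^sub>p" "r\<^sub>p \<le> sqrt 2" and P: "capacity_achieving r\<^sub>p r\<^sub>m P"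
  shows "AE x in P. (fst x)\<^sup>2 / r\<^sub>p\<^sup>2 + (snd x)\<^sup>2 / r\<^sub>m\<^sup>2 = 1"
proof (rule ccontr)
  let ?q = "\<lambda>x. (fst x)\<^sup>2 / r\<^sub>p\<^sup>2 + (snd x)\<^sup>2 / r\<^sub>m\<^sup>2"
  assume nq: "\<not> (AE x in P. ?q x = 1)"
  have r0: "0 \<le> r\<^sub>m" "0 < r\<^sub>p"
    using r by auto
  have aP: "admissible_input r\<^sub>p r\<^sub>m P"
    using P by (auto simp: capacity_achieving_def is_arg_max_def)
  have ell: "x \<in> ellipse r\<^sub>p r\<^sub>m \<longleftrightarrow> ?q x \<le> 1" for x
    using r by (auto simp: ellipse_def split_beta')
  interpret bounded_input P r\<^sub>p
    using bounded_input_admissible[OF r0(1) r(2) aP] .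
  \<comment> \<open>The same law in the disc of radius \<open>sqrt 2\<close>, the radius for which
    subharmonicity is stated.\<close>
  interpret b2: bounded_input P "sqrt 2"
    using bounded r(3) by unfold_locales (auto elim: eventually_mono)
  have AE_ell: "AE x in P. x \<in> ellipse r\<^sub>p r\<^sub>m"
    using aP by (simp add: admissible_input_def)
  \<comment> \<open>On the ellipse |x|^2 = 2 gives 1 \<le> |x|^2 / \<open>r\<^sub>p\<^sup>2\<close>
    \<le> \<open>?q x\<close> \<le> 1, so a law on this circle would already live on the
    boundary.\<close>
  have nb: "\<not> (AE x in P. x \<bullet> x = 2)"
  proof
    assume "AE x in P. x \<bullet> x = 2"
    with AE_ell have "AE x in P. ?q x = 1"
    proof eventually_elim
      case (elim x)
      have "r\<^sub>p\<^sup>2 \<le> 2"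
        using power_mono[OF r(3), of 2] r0 by simp
      then have "1 \<le> x \<bullet> x / r\<^sub>p\<^sup>2"
        using elim r0 by simp
      also have "\<dots> = (fst x)\<^sup>2 / r\<^sub>p\<^sup>2 + (snd x)\<^sup>2 / r\<^sub>p\<^sup>2"
        by (simp add: inner_prod_def power2_eq_square add_divide_distrib)
      also have "\<dots> \<le> ?q x"
        using r by (intro add_left_mono divide_left_mono power_mono) auto
      finally show ?case
        using elim(1) by (simp add: ell)
    qed
    with nq show False ..
  qed
  have "\<exists>x. x \<in> ellipse r\<^sub>p r\<^sub>m \<and> input_divergence P x = channel_information P \<and> ?q x \<noteq> 1"
  proof (rule ccontr)
    assume none: "\<not> ?thesis"
    have "AE x in P. ?q x = 1"
      using AE_ell AE_input_divergence_eq_capacity[OF r0(1) r(2) P]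
      by eventually_elim (use none in blast)
    with nq show False ..
  qed
  then obtain x where x: "input_divergence P x = channel_information P" "?q x < 1"
    by (auto simp: ell less_le)
  \<comment> \<open>The point is interior, so by continuity its small displacements remain in the
    ellipse, where the capacity bound holds.\<close>
  have near: "eventually (\<lambda>t. x + f t \<in> ellipse r\<^sub>p r\<^sub>m) (at_right 0)"
    if "(f \<longlongrightarrow> 0) (at_right (0::real))" for f :: "real \<Rightarrow> real \<times> real"
  proof -
    have "((\<lambda>t. ?q (x + f t)) \<longlongrightarrow> ?q (x + 0)) (at_right 0)"
      using r r0 by (intro tendsto_intros that) auto
    then have "eventually (\<lambda>t. ?q (x + f t) < 1) (at_right 0)"
      using x(2) by (intro order_tendstoD(2)) auto
    then show ?thesis
      by eventually_elim (simp add: ell)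
  qed
  have "((\<lambda>t. (t, 0)) \<longlongrightarrow> (0, 0 :: real)) (at_right (0::real))"
    "((\<lambda>t. (0, t)) \<longlongrightarrow> (0 :: real, 0)) (at_right (0::real))"
    by (intro tendsto_intros)+
  then have lim: "((\<lambda>t. (t, 0)) \<longlongrightarrow> (0 :: real \<times> real)) (at_right (0::real))"
    "((\<lambda>t. (0, t)) \<longlongrightarrow> (0 :: real \<times> real)) (at_right (0::real))"
    by (simp_all add: zero_prod_def)
  note near[OF lim(1)] near[OF tendsto_minus[OF lim(1), simplified]]
    near[OF lim(2)] near[OF tendsto_minus[OF lim(2), simplified]]
    b2.input_divergence_strictly_subharmonic[OF refl nb, of x]
  \<comment> \<open>At the maximum point the four neighbours sum to at most four times the central
    value, against strict subharmonicity.\<close>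
  then have "eventually (\<lambda>t::real. False) (at_right 0)"
  proof eventually_elim
    case (elim t)
    note D = input_divergence_le_capacity[OF r0(1) r(2) P]
    have minus: "x + (- t, 0) = x - (t, 0)" "x + (0, - t) = x - (0, t)"
      by (simp_all add: prod_eq_iff)
    show ?case
      using D[OF elim(1)] D[OF elim(2)] D[OF elim(3)] D[OF elim(4)] elim(5) x(1)
      unfolding minus by linarith
  qed
  then show False
    by simp
qed

section \<open>The conditional law and the final statement\<close>

lemma measurable_half_half:
  assumes [measurable]: "f \<in> borel_measurable borel" "g \<in> borel_measurable borel"
  shows "(\<lambda>x. half_half (f x) (g x)) \<in> borel \<rightarrow>\<^sub>M prob_algebra borel"
proof (rule measurable_prob_algebra_generated[where \<Omega> = UNIV and G = "sets borel"])
  show "sets borel = sigma_sets UNIV (sets (borel :: real measure))"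
    using sets.sigma_sets_eq[of "borel :: real measure"] by simp
  fix A :: "real set"
  assume [measurable]: "A \<in> sets borel"
  show "(\<lambda>x. emeasure (half_half (f x) (g x)) A) \<in> borel_measurable borel"
    by (simp add: emeasure_half_half)
qed (auto simp: sets.Int_stable prob_space_half_half)

lemma half_add_half_ennreal: "1 / 2 * a + 1 / 2 * a = (a :: ennreal)"
proof -
  have "1/2 + 1/2 = (1::ennreal)"
    by (simp flip: add_divide_distrib_ennreal)
  then show ?thesis
    by (simp flip: distrib_right)
qed

theorem proposition1:
  fixes r\<^sub>p r\<^sub>m :: real
    and M :: "'a measure"
    and X\<^sub>1 X\<^sub>2 :: "'a \<Rightarrow> real"
  assumes "0 \<le> r\<^sub>m" "r\<^sub>m \<le> r\<^sub>p"
    and "prob_space M"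
    and "X\<^sub>1 \<in> borel_measurable M" "X\<^sub>2 \<in> borel_measurable M"
    and "capacity_achieving r\<^sub>p r\<^sub>m (distr M borel (\<lambda>\<omega>. (X\<^sub>1 \<omega>, X\<^sub>2 \<omega>)))"
  shows "distr M borel X\<^sub>1 = distr M borel (\<lambda>\<omega>. - X\<^sub>1 \<omega>) \<and>
    distr M borel X\<^sub>2 = distr M borel (\<lambda>\<omega>. - X\<^sub>2 \<omega>) \<and>
    (0 < r\<^sub>m \<and> r\<^sub>p \<le> sqrt 2 \<longrightarrow>
      is_regular_cond_distr M borel borel X\<^sub>1 X\<^sub>2
        (\<lambda>x\<^sub>1. half_half (r\<^sub>m * sqrt (1 - x\<^sub>1\<^sup>2 / r\<^sub>p\<^sup>2)) (- (r\<^sub>m * sqrt (1 - x\<^sub>1\<^sup>2 / r\<^sub>p\<^sup>2)))))"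
proof (intro conjI impI)
  note r = assms(1,2)
  note [measurable] = assms(4,5)
  interpret prob_space M by fact
  let ?P = "distr M borel (\<lambda>\<omega>. (X\<^sub>1 \<omega>, X\<^sub>2 \<omega>))"
  have pair [measurable]: "(\<lambda>\<omega>. (X\<^sub>1 \<omega>, X\<^sub>2 \<omega>)) \<in> borel_measurable M"
    by (rule borel_measurable_Pair) measurable
  have sym: "distr M borel (\<lambda>\<omega>. reflect a b (X\<^sub>1 \<omega>, X\<^sub>2 \<omega>)) = ?P" if "\<bar>a\<bar> = 1" "\<bar>b\<bar> = 1" for a b
    using capacity_achieving_reflect[OF r assms(6) that] by (simp add: distr_distr comp_def)
  have distr_comp: "distr (distr M borel f) borel g = distr M borel (\<lambda>\<omega>. g (f \<omega>))"
    if "f \<in> borel_measurable M" "g \<in> borel_measurable borel"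
    for f :: "'a \<Rightarrow> real \<times> real" and g :: "real \<times> real \<Rightarrow> real"
    using that by (simp add: distr_distr comp_def)
  \<comment> \<open>Negating both coordinates at once gives the symmetry of either marginal, by
    projecting.\<close>
  have "distr ?P borel g = distr M borel (\<lambda>\<omega>. g (reflect (- 1) (- 1) (X\<^sub>1 \<omega>, X\<^sub>2 \<omega>)))"
    if "g \<in> borel_measurable borel" for g :: "real \<times> real \<Rightarrow> real"
    by (subst sym[of "- 1" "- 1", symmetric]) (simp_all add: distr_comp that)
  note neg = this[of fst] this[of snd]
  show "distr M borel X\<^sub>1 = distr M borel (\<lambda>\<omega>. - X\<^sub>1 \<omega>)"
    "distr M borel X\<^sub>2 = distr M borel (\<lambda>\<omega>. - X\<^sub>2 \<omega>)"
    using neg by (simp_all add: distr_comp reflect_def)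

  assume "0 < r\<^sub>m \<and> r\<^sub>p \<le> sqrt 2"
  then have r': "0 < r\<^sub>m" "r\<^sub>p \<le> sqrt 2" by auto
  \<comment> \<open>For |x| > \<open>r\<^sub>p\<close> the argument of \<open>sqrt\<close> is
    negative and \<open>sqrt\<close> takes its odd extension; the kernel is still a probability
    measure there, and the law of \<open>X\<^sub>1\<close> does not charge this region.\<close>
  define s where "s x = r\<^sub>m * sqrt (1 - x\<^sup>2 / r\<^sub>p\<^sup>2)" for x
  have [measurable]: "s \<in> borel_measurable borel"
    unfolding s_def[abs_def] by measurable
  have "AE x in ?P. (fst x)\<^sup>2 / r\<^sub>p\<^sup>2 + (snd x)\<^sup>2 / r\<^sub>m\<^sup>2 = 1"
    using capacity_achieving_boundary[OF r'(1) r(2) r'(2) assms(6)] .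
  then have "AE \<omega> in M. (X\<^sub>1 \<omega>)\<^sup>2 / r\<^sub>p\<^sup>2 + (X\<^sub>2 \<omega>)\<^sup>2 / r\<^sub>m\<^sup>2 = 1"
    by (subst (asm) AE_distr_iff) simp_all
  then have X2: "AE \<omega> in M. X\<^sub>2 \<omega> = s (X\<^sub>1 \<omega>) \<or> X\<^sub>2 \<omega> = - s (X\<^sub>1 \<omega>)"
  proof eventually_elim
    case (elim \<omega>)
    then have "1 - (X\<^sub>1 \<omega>)\<^sup>2 / r\<^sub>p\<^sup>2 = (X\<^sub>2 \<omega> / r\<^sub>m)\<^sup>2"
      by (simp add: power_divide)
    then have "s (X\<^sub>1 \<omega>) = \<bar>X\<^sub>2 \<omega>\<bar>"
      using r'(1) by (simp add: s_def)
    then show ?case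
      by linarith
  qed
  have "is_regular_cond_distr M borel borel X\<^sub>1 X\<^sub>2 (\<lambda>x. half_half (s x) (- s x))"
    unfolding is_regular_cond_distr_def
  proof (intro conjI ballI)
    show "(\<lambda>x. half_half (s x) (- s x)) \<in> borel \<rightarrow>\<^sub>M prob_algebra borel"
      by (rule measurable_half_half) measurable
    fix A B :: "real set"
    assume [measurable]: "A \<in> sets borel" "B \<in> sets borel"
    have AB [measurable]: "A \<times> B \<in> sets borel"
      by (simp flip: borel_prod)
    let ?a = "emeasure M {\<omega> \<in> space M. X\<^sub>1 \<omega> \<in> A \<and> X\<^sub>2 \<omega> \<in> B}"
    \<comment> \<open>Invariance under a sign change of the second coordinate alone, evaluated on
      the rectangle \<open>A \<times> B\<close>.\<close>
    have flip: "emeasure M {\<omega> \<in> space M. X\<^sub>1 \<omega> \<in> A \<and> - X\<^sub>2 \<omega> \<in> B} = ?a"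
    proof -
      have "emeasure (distr M borel (\<lambda>\<omega>. reflect 1 (- 1) (X\<^sub>1 \<omega>, X\<^sub>2 \<omega>))) (A \<times> B) = emeasure ?P (A \<times> B)"
        by (simp add: sym)
      then show ?thesis
        by (simp add: emeasure_distr reflect_def vimage_def Int_def conj_commute conj_left_commute)
    qed
    have "(\<integral>\<^sup>+ x\<in>A. emeasure (half_half (s x) (- s x)) B \<partial>distr M borel X\<^sub>1) =
        (\<integral>\<^sup>+\<omega>. (1 / 2 * indicator B (s (X\<^sub>1 \<omega>)) + 1 / 2 * indicator B (- s (X\<^sub>1 \<omega>))) * indicator A (X\<^sub>1 \<omega>) \<partial>M)"
      by (simp add: emeasure_half_half nn_integral_distr)
    \<comment> \<open>Whichever sign \<open>X\<^sub>2\<close> carries, the pair of atoms is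
      \<open>X\<^sub>2\<close> and \<open>- X\<^sub>2\<close> in some order, and the sum with equal
      weights does not see the order.\<close>
    also have "\<dots> = (\<integral>\<^sup>+\<omega>. 1 / 2 * indicator {\<omega> \<in> space M. X\<^sub>1 \<omega> \<in> A \<and> X\<^sub>2 \<omega> \<in> B} \<omega> +
        1 / 2 * indicator {\<omega> \<in> space M. X\<^sub>1 \<omega> \<in> A \<and> - X\<^sub>2 \<omega> \<in> B} \<omega> \<partial>M)"
    proof (rule nn_integral_cong_AE)
      show "AE \<omega> in M. (1 / 2 * indicator B (s (X\<^sub>1 \<omega>)) + 1 / 2 * indicator B (- s (X\<^sub>1 \<omega>))) * indicator A (X\<^sub>1 \<omega>) =
        1 / 2 * indicator {\<omega> \<in> space M. X\<^sub>1 \<omega> \<in> A \<and> X\<^sub>2 \<omega> \<in> B} \<omega> +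
        1 / 2 * (indicator {\<omega> \<in> space M. X\<^sub>1 \<omega> \<in> A \<and> - X\<^sub>2 \<omega> \<in> B} \<omega> :: ennreal)"
        using X2 AE_space
      proof eventually_elim
        case (elim \<omega>)
        from elim(1) show ?case
          using elim(2) by (elim disjE) (auto simp: indicator_def)
      qed
    qed
    also have "\<dots> = 1 / 2 * ?a + 1 / 2 * ?a"
      by (simp add: nn_integral_add nn_integral_cmult flip)
    finally show "?a = (\<integral>\<^sup>+ x\<in>A. emeasure (half_half (s x) (- s x)) B \<partial>distr M borel X\<^sub>1)"
      by (simp add: half_add_half_ennreal)
  qed
  then show "is_regular_cond_distr M borel borel X\<^sub>1 X\<^sub>2
      (\<lambda>x\<^sub>1. half_half (r\<^sub>m * sqrt (1 - x\<^sub>1\<^sup>2 / r\<^sub>p\<^sup>2)) (- (r\<^sub>m * sqrt (1 - x\<^sub>1\<^sup>2 / r\<^sub>p\<^sup>2))))"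
    unfolding s_def .
qed

end
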